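(* Let $d>2$ be an even integer and $\lambda=\frac{d-2}{2}$. There is a constant $c>0$ such that, if $f\in\mathcal{S}(\mathbb{R}^d)\otimes\mathbb{R}_d$ and $g\in\mathcal{S}(\mathbb{R}^d)$ is a (real-valued) radial function, then for all $\theta,\eta,\mu,x,\omega\in\mathbb{R}^d$ $$|\mathcal{V}_{\tau_\theta g}M_\eta\tau_\mu f(x,\omega)|\le c\,(1+|\underline\omega|)^\lambda(1+|\underline\eta|)^\lambda(1+|\underline\mu|)^\lambda(1+|\underline\theta|)^{3\lambda}\left((1+|\cdot|)^{3\lambda}*|g|\right)(x)\int_{\mathbb{R}^d}(1+|\underline\xi|)^{2\lambda}\,|\mathcal{F}_-f(\xi)|\,d\xi,$$ where $\left((1+|\cdot|)^{3\lambda}*|g|\right)(x)=\int_{\mathbb{R}^d}(1+|\underline z|)^{3\lambda}|g(x-z)|\,dz$.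
   Context: $\mathbb{R}_d$ is the real Clifford algebra generated by $e_1,\dots,e_d$ with $e_je_k+e_ke_j=-2\delta_{jk}$; a vector $x\in\mathbb{R}^d$ is identified with $\underline{x}=\sum_j x_je_j$, with Euclidean norm $|\underline{x}|$, and $\underline{x}\wedge\underline{y}=\sum_{j<k}e_je_k(x_jy_k-x_ky_j)$. For $a=\sum_A a_Ae_A\in\mathbb{R}_d$, $|a|=(\sum_A a_A^2)^{1/2}$. $\mathcal{S}(\mathbb{R}^d)\otimes\mathbb{R}_d$ is the space of $\mathbb{R}_d$-valued Schwartz functions. Radial means $g(x)=g_0(|\underline{x}|)$ with $g_0$ real-valued. Put $\lambda=\frac{d-2}{2}$. For $d$ even the Clifford-Fourier kernel $K_-(x,y)=e^{i\frac{\pi}{2}\Gamma_{\underline y}}e^{-i\langle\underline x,\underline y\rangle}$ (where $\Gamma_{\underline y}=-\sum_{j<k}e_je_k(y_j\partial_{y_k}-y_k\partial_{y_j})$) is the $\mathbb{R}_d$-valued function $$K_-(x,y)=(-1)^{\lambda+1}\left(\tfrac{\pi}{2}\right)^{1/2}\left(A^*_\lambda(s,t)+B^*_\lambda(s,t)+(\underline x\wedge\underline y)C^*_\lambda(s,t)\right),$$ with $s=\langle\underline x,\underline y\rangle=\sum_j x_jy_j$, $t=\sqrt{|\underline x|^2|\underline y|^2-s^2}$, $\tilde J_\alpha(t)=t^{-\alpha}J_\alpha(t)$ ($J_\alpha$ the Bessel function; value at $t=0$ by continuity), and $A^*_\lambda=\sum_{l=0}^{\lfloor\frac{\lambda+1}{2}-\frac34\rfloor}s^{\lambda-1-2l}\frac{1}{2^ll!}\frac{\Gamma(\lambda+1)}{\Gamma(\lambda-2l)}\tilde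 J_{(2\lambda-2l-1)/2}(t)$, $B^*_\lambda=-\sum_{l=0}^{\lfloor\lambda/2\rfloor}s^{\lambda-2l}\frac{1}{2^ll!}\frac{\Gamma(\lambda+1)}{\Gamma(\lambda-2l+1)}\tilde J_{(2\lambda-2l-1)/2}(t)$, $C^*_\lambda=-\sum_{l=0}^{\lfloor\lambda/2\rfloor}s^{\lambda-2l}\frac{1}{2^ll!}\frac{\Gamma(\lambda+1)}{\Gamma(\lambda-2l+1)}\tilde J_{(2\lambda-2l+1)/2}(t)$. Clifford-Fourier transform: $\mathcal{F}_-f(y)=(2\pi)^{-d/2}\int_{\mathbb{R}^d}K_-(x,y)f(x)\,dx$. For $d$ even, $\mathcal{F}_-$ maps $\mathcal{S}(\mathbb{R}^d)\otimes\mathbb{R}_d$ to itself and $\mathcal{F}_-\mathcal{F}_-=\mathrm{Id}$. Generalized translation: $\mathcal{F}_-(\tau_yf)(x)=K_-(y,x)\mathcal{F}_-f(x)$, i.e. $\tau_yf(x)=(2\pi)^{-d/2}\int_{\mathbb{R}^d}K_-(\xi,x)K_-(y,\xi)\mathcal{F}_-f(\xi)\,d\xi$; for radial $g\in\mathcal{S}(\mathbb{R}^d)$, $\tau_yg(x)=g(x-y)$. Generalized modulation: $M_yf(x)=K_-(y,x)f(x)$. For a real-valued window $h$, the Clifford short-time Fourier transform is $\mathcal{V}_hf(x,\omega)=(2\pi)^{-d/2}\int_{\mathbb{R}^d}K_-(t,\omega)h(t-x)f(t)\,dt$. In particular, for $g$ radial, $\mathcal{V}_{\tau_\theta g}F(x,\omega)=(2\pi)^{-d/2}\int_{\mathbb{R}^d}K_-(t,\omega)\,g(t-x-\theta)\,F(t)\,dt$;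 here $F=M_\eta\tau_\mu f$. *)

theory Defs
  imports "HOL-Analysis.Analysis"
begin

section \<open>The real Clifford algebra\<close>

text \<open>
  An element \<open>a = \<Sum>\<^sub>A a\<^sub>A e\<^sub>A\<close> is its vector of coefficients, indexed by the subsets \<open>A\<close> of the
  index type, so that \<^const>\<open>norm\<close> is \<open>(\<Sum>\<^sub>A a\<^sub>A\<^sup>2)\<^bsup>1/2\<^esup>\<close>. The linear order on the index type fixes
  \<open>e\<^sub>A = e\<^bsub>j\<^sub>1\<^esub> \<dots> e\<^bsub>j\<^sub>k\<^esub>\<close> for \<open>A = {j\<^sub>1 < \<dots> < j\<^sub>k}\<close>. Beware that \<open>*\<close> on this type is the componentwise
  product; the Clifford product is \<open>\<star>\<close>, defined below.
\<close>

type_synonym 'n clifford = "real ^ ('n set)"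

text \<open>
  \<open>e\<^sub>A e\<^sub>B = \<plusminus> e\<^bsub>A \<triangle> B\<^esub>\<close>: each pair \<open>k < j\<close> (with \<open>j \<in> A\<close>, \<open>k \<in> B\<close>) costs one transposition, and each
  common index one factor \<open>e\<^sub>j\<^sup>2 = -1\<close>.
\<close>

definition clifford_sign :: "'n::{finite,linorder} set \<Rightarrow> 'n set \<Rightarrow> real" where
  "clifford_sign A B = (-1) ^ card {(j, k). j \<in> A \<and> k \<in> B \<and> k \<le> j}"

definition clifford_mult ::
    "'n::{finite,linorder} clifford \<Rightarrow> 'n clifford \<Rightarrow> 'n clifford" (infixl \<open>\<star>\<close> 70) where
  "a \<star> b = (\<Sum>A\<in>UNIV. \<Sum>B\<in>UNIV.
     (clifford_sign A B * (a $ A) * (b $ B)) *\<^sub>R axis ((A - B) \<union> (B - A)) 1)"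

definition clifford_one :: "'n::{finite,linorder} clifford" where
  "clifford_one = axis {} 1"

definition clifford_e :: "'n::{finite,linorder} \<Rightarrow> 'n clifford" where
  "clifford_e j = axis {j} 1"

lemma clifford_mult_axis:
  "axis A 1 \<star> axis B 1 = clifford_sign A B *\<^sub>R axis ((A - B) \<union> (B - A)) 1"
proof -
  let ?P = "clifford_sign A B *\<^sub>R axis ((A - B) \<union> (B - A)) (1::real)"
  have *: "(clifford_sign A' B' * (axis A 1 $ A') * (axis B 1 $ B')) *\<^sub>R axis ((A' - B') \<union> (B' - A')) (1::real)
      = (if B' = B then if A' = A then ?P else 0 else 0)" for A' B'
    by (simp add: axis_def)
  show ?thesis
    unfolding clifford_mult_def * by (simp add: sum.delta)
qed

lemma clifford_e_anticommute:
  "clifford_e j \<star> clifford_e k + clifford_e k \<star> clifford_e j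
     = (if j = k then -2 else 0) *\<^sub>R clifford_one"
proof -
  have sgn: "clifford_sign {a} {b} = (if b \<le> a then -1 else 1)" for a b :: "'a::{finite,linorder}"
  proof -
    have "{(j', k'). j' \<in> {a} \<and> k' \<in> {b} \<and> k' \<le> j'} = (if b \<le> a then {(a, b)} else {})"
      by auto
    then show ?thesis by (simp add: clifford_sign_def)
  qed
  show ?thesis
  proof (cases "j = k")
    case True
    then show ?thesis
      by (simp add: clifford_e_def clifford_one_def clifford_mult_axis sgn flip: scaleR_2)
  next
    case False
    moreover have "({k} - {j}) \<union> ({j} - {k}) = ({j} - {k}) \<union> ({k} - {j})" by auto
    ultimately show ?thesis
      by (auto simp: clifford_e_def clifford_mult_axis sgn)
  qed
qed

definition clifford_wedge ::
    "(real, 'n) vec \<Rightarrow> (real, 'n) vec \<Rightarrow> 'n::{finite,linorder} clifford" where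
  "clifford_wedge x y = (\<Sum>(j, k) \<in> {(j, k). j < k}.
     (x $ j * y $ k - x $ k * y $ j) *\<^sub>R (clifford_e j \<star> clifford_e k))"

section \<open>Schwartz functions\<close>

definition partial_deriv ::
    "'n::finite \<Rightarrow> (real ^ 'n \<Rightarrow> 'b::real_normed_vector) \<Rightarrow> real ^ 'n \<Rightarrow> 'b" where
  "partial_deriv i f x = vector_derivative (\<lambda>h. f (x + h *\<^sub>R axis i 1)) (at 0)"

text \<open>
  A function is smooth iff all its iterated partial derivatives exist and are (Frechet) differentiable.
\<close>

definition schwartz :: "(real ^ 'n::finite \<Rightarrow> 'b::real_normed_vector) \<Rightarrow> bool" where
  "schwartz f \<longleftrightarrow> (\<forall>is :: 'n list.
     (\<forall>x. foldr partial_deriv is f differentiable (at x)) \<and>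
     (\<forall>N :: nat. bounded (range (\<lambda>x. (1 + norm x) ^ N *\<^sub>R foldr partial_deriv is f x))))"

definition radial :: "(real ^ 'n::finite \<Rightarrow> real) \<Rightarrow> bool" where
  "radial g \<longleftrightarrow> (\<exists>g0 :: real \<Rightarrow> real. \<forall>x. g x = g0 (norm x))"

section \<open>The Clifford-Fourier kernel in even dimension\<close>

text \<open>The series below is meant for \<open>u > 0\<close> only.\<close>

definition bessel_J :: "real \<Rightarrow> real \<Rightarrow> real" where
  "bessel_J a u = (\<Sum>k. (-1) ^ k / (fact k * Gamma (real k + a + 1)) * (u / 2) powr (2 * real k + a))"

definition bessel_J_tilde :: "real \<Rightarrow> real \<Rightarrow> real" where
  "bessel_J_tilde a u =
     (if u = 0 then Lim (at_right 0) (\<lambda>v. v powr (-a) * bessel_J a v) else u powr (-a) * bessel_J a u)"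

text \<open>
  The argument \<open>lam\<close> is \<open>(d - 2)/2\<close>. In all three sums the exponents of \<open>s\<close> are nonnegative,
  so truncated subtraction is harmless there.
\<close>

definition A_star :: "nat \<Rightarrow> real \<Rightarrow> real \<Rightarrow> real" where
  "A_star lam s t = (\<Sum>l | int l \<le> \<lfloor>(real lam + 1) / 2 - 3 / 4\<rfloor>.
     s ^ (lam - 1 - 2 * l) * (1 / (2 ^ l * fact l)) * (Gamma (real lam + 1) / Gamma (real lam - 2 * real l))
       * bessel_J_tilde ((2 * real lam - 2 * real l - 1) / 2) t)"

definition B_star :: "nat \<Rightarrow> real \<Rightarrow> real \<Rightarrow> real" where
  "B_star lam s t = - (\<Sum>l | int l \<le> \<lfloor>real lam / 2\<rfloor>.
     s ^ (lam - 2 * l) * (1 / (2 ^ l * fact l)) * (Gamma (real lam + 1) / Gamma (real lam - 2 * real l + 1))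
       * bessel_J_tilde ((2 * real lam - 2 * real l - 1) / 2) t)"

definition C_star :: "nat \<Rightarrow> real \<Rightarrow> real \<Rightarrow> real" where
  "C_star lam s t = - (\<Sum>l | int l \<le> \<lfloor>real lam / 2\<rfloor>.
     s ^ (lam - 2 * l) * (1 / (2 ^ l * fact l)) * (Gamma (real lam + 1) / Gamma (real lam - 2 * real l + 1))
       * bessel_J_tilde ((2 * real lam - 2 * real l + 1) / 2) t)"

definition clifford_kernel ::
    "(real, 'n) vec \<Rightarrow> (real, 'n) vec \<Rightarrow> 'n::{finite,linorder} clifford" where
  "clifford_kernel x y =
     (let lam = (CARD('n) - 2) div 2;
          s = x \<bullet> y;
          t = sqrt ((norm x)\<^sup>2 * (norm y)\<^sup>2 - s\<^sup>2)
      in ((-1) ^ (lam + 1) * sqrt (pi / 2)) *\<^sub>R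
           ((A_star lam s t + B_star lam s t) *\<^sub>R clifford_one + C_star lam s t *\<^sub>R clifford_wedge x y))"

section \<open>Transform, translation, modulation, short-time transform\<close>

definition clifford_fourier ::
    "((real, 'n) vec \<Rightarrow> 'n clifford) \<Rightarrow> (real, 'n) vec \<Rightarrow> 'n::{finite,linorder} clifford" where
  "clifford_fourier f y = (2 * pi) powr (- (real CARD('n) / 2)) *\<^sub>R
     (\<integral>x. clifford_kernel x y \<star> f x \<partial>lborel)"

definition clifford_translation ::
    "(real, 'n) vec \<Rightarrow> ((real, 'n) vec \<Rightarrow> 'n clifford) \<Rightarrow> (real, 'n) vec \<Rightarrow> 'n::{finite,linorder} clifford" where
  "clifford_translation y f x = (2 * pi) powr (- (real CARD('n) / 2)) *\<^sub>R
     (\<integral>\<xi>. clifford_kernel \<xi> x \<star> clifford_kernel y \<xi> \<star> clifford_fourier f \<xi> \<partial>lborel)"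

text \<open>
  The generalized translation of a real-valued radial Schwartz function is the real-valued function
  \<open>x \<mapsto> g (x - y)\<close>; in this form it can serve as the real window of the short-time transform.
\<close>

definition radial_translation :: "(real, 'n::finite) vec \<Rightarrow> ((real, 'n) vec \<Rightarrow> real) \<Rightarrow> (real, 'n) vec \<Rightarrow> real" where
  "radial_translation y g x = g (x - y)"

definition clifford_modulation ::
    "(real, 'n) vec \<Rightarrow> ((real, 'n) vec \<Rightarrow> 'n clifford) \<Rightarrow> (real, 'n) vec \<Rightarrow> 'n::{finite,linorder} clifford" where
  "clifford_modulation y f x = clifford_kernel y x \<star> f x"

definition clifford_stft ::
    "((real, 'n) vec \<Rightarrow> real) \<Rightarrow> ((real, 'n) vec \<Rightarrow> 'n clifford) \<Rightarrow> (real, 'n) vec \<Rightarrow> (real, 'n) vec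
      \<Rightarrow> 'n::{finite,linorder} clifford" where
  "clifford_stft h f x \<omega> = (2 * pi) powr (- (real CARD('n) / 2)) *\<^sub>R
     (\<integral>t. clifford_kernel t \<omega> \<star> (h (t - x) *\<^sub>R f t) \<partial>lborel)"

end

theory Submission
  imports Defs
begin

text \<open>
  The estimate itself is a chain of triangle inequalities based on the kernel bound
  \<open>|K(x, y)| \<le> C (1 + |x|)\<^sup>\<lambda> (1 + |y|)\<^sup>\<lambda>\<close>. Since \<open>t\<^bsup>-a\<^esup> J\<^sub>a(t)\<close> is an entire function \<open>j\<^sub>a\<close> of \<open>u = t\<^sup>2\<close>
  with \<open>j\<^sub>a' = - j\<^bsub>a+1\<^esub> / 2\<close>, the energy \<open>j\<^sub>a\<^sup>2 + u j\<^bsub>a+1\<^esub>\<^sup>2\<close> is nonincreasing for \<open>a \<ge> -1/2\<close>; it bounds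
  \<open>j\<^sub>a\<close> and \<open>t j\<^bsub>a+1\<^esub>\<close>, and the factor \<open>t\<close> is the size of \<open>x \<and> y\<close>.

  The integral of a non-integrable function is \<open>0\<close> by convention, so the right-hand side is only
  meaningful because the transform of a Schwartz function decays rapidly. This holds because the
  kernel satisfies \<open>\<Delta>\<^sub>x K(x, y) = - |y|\<^sup>2 K(x, y)\<close>: integrating by parts \<open>2N\<close> times gains a factor
  \<open>|y|\<^bsup>-2N\<^esup>\<close>.
\<close>

text \<open>Why the kernel is an eigenfunction is a matter of variables. In s = <x, y> and u = t^2
  the three sums are, up to sign and the factor \<open>fact lam\<close>, members of one family
  \<open>bessel_appell\<close>, on which d/ds lowers the degree m and d/du raises the Bessel index
  b. With y fixed, grad s and grad u are orthogonal, |grad s|^2 = |y|^2, |grad u|^2 = 4 |y|^2 u, and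
  the Laplacian of u is 2 (d - 1) |y|^2, so the eigenvalue equation reduces to the three-term Bessel
  recurrence. It closes when 2 (b + 1) = d - 1 for the scalar sums and 2 (b + 1) = d + 1 for the
  wedge term, that is for b = lam - 1/2 and b = lam + 1/2. The same values keep every Bessel index b
  - l at or above -1/2, within reach of the energy bound. The exponents of the theorem count
  kernels. The variable \<xi> lies in two of them, giving 2 lam. The variable t lies in three (from
  the transform, the modulation and the translated f), giving 3 lam, and the shift of the window by
  \<theta> carries 3 lam over to 1 + |\<theta>|.\<close>

section \<open>Bessel functions as entire functions of the square of the argument\<close>

text \<open>Taylor coefficients of \<open>t powr (-a) * bessel_J a t\<close> in the variable t^2.
  The reciprocal Gamma function is entire, so the identities below hold for every real a, with no
  poles to exclude.\<close>

definition bessel_coeff :: "real \<Rightarrow> nat \<Rightarrow> real" where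
  "bessel_coeff a k = (-1) ^ k * rGamma (real k + a + 1) / (fact k * 4 ^ k * 2 powr a)"

definition bessel_sq :: "real \<Rightarrow> real \<Rightarrow> real" where
  "bessel_sq a u = (\<Sum>k. bessel_coeff a k * u ^ k)"

lemma bessel_coeff_shift:
  "bessel_coeff a (Suc k)
     = - ((-1) ^ k * rGamma (real k + a + 2)) / (4 * real (Suc k) * (fact k * 4 ^ k * 2 powr a))"
  by (simp add: bessel_coeff_def mult_ac add_ac)

text \<open>Solved for the lower coefficient, since the factor k + a + 1 vanishes for some k when a
  is a negative integer and could not be divided by.\<close>

lemma bessel_coeff_Suc:
  "bessel_coeff a k = - (4 * real (Suc k) * (real k + a + 1)) * bessel_coeff a (Suc k)"
proof -
  have "rGamma (real k + a + 1) = (real k + a + 1) * rGamma (real k + a + 2)"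
    using rGamma_plus1[of "real k + a + 1"] by (simp add: add_ac)
  moreover have "- (4 * n * x) * (- (e * r) / (4 * n * q)) = e * (x * r) / q" if "n \<noteq> 0" for n x e r q :: real
    using that by simp
  ultimately show ?thesis
    unfolding bessel_coeff_shift by (simp only: bessel_coeff_def of_nat_neq_0 not_False_eq_True)
qed

lemma summable_bessel: "summable (\<lambda>k. bessel_coeff a k * u ^ k)"
proof -
  \<comment> \<open>From this index on, k + a + 1 >= 1 and 4 (k + 1) >= 2 |u|, which forces the
    ratio of consecutive terms below 1/2.\<close>
  define N where "N = nat \<lceil>\<bar>a\<bar> + \<bar>u\<bar>\<rceil> + 1"
  have "norm (bessel_coeff a (Suc k) * u ^ Suc k) \<le> 1 / 2 * norm (bessel_coeff a k * u ^ k)"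
    if "N \<le> k" for k
  proof -
    have k: "\<bar>a\<bar> + \<bar>u\<bar> + 1 \<le> real k" using that unfolding N_def by linarith
    have "\<bar>u\<bar> * 2 \<le> (4 * real (Suc k)) * 1" using k by simp
    also have "\<dots> \<le> (4 * real (Suc k)) * (real k + a + 1)"
      using k by (intro mult_left_mono) auto
    finally have u: "\<bar>u\<bar> * 2 \<le> \<bar>4 * real (Suc k) * (real k + a + 1)\<bar>" by linarith
    have "2 * norm (bessel_coeff a (Suc k) * u ^ Suc k)
        = (\<bar>u\<bar> * 2) * (\<bar>bessel_coeff a (Suc k)\<bar> * \<bar>u\<bar> ^ k)"
      by (simp add: abs_mult power_abs)
    also have "\<dots> \<le> \<bar>4 * real (Suc k) * (real k + a + 1)\<bar> * (\<bar>bessel_coeff a (Suc k)\<bar> * \<bar>u\<bar> ^ k)"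
      by (intro mult_right_mono u) auto
    also have "\<dots> = norm (bessel_coeff a k * u ^ k)"
      by (subst bessel_coeff_Suc) (simp only: real_norm_def abs_mult power_abs abs_minus_cancel mult.assoc)
    finally show ?thesis by simp
  qed
  then show ?thesis by (intro summable_ratio_test[of "1 / 2" N]) simp_all
qed

lemma diffs_bessel_coeff: "diffs (bessel_coeff a) k = - (1/2) * bessel_coeff (a + 1) k"
proof -
  have "n * (- x / (4 * n * (f * q * p))) = - (1/2) * (x / (f * q * (p * 2)))" if "n \<noteq> 0" for n x f q p :: real
    using that by (simp add: field_simps)
  moreover have "real k + (a + 1) + 1 = real k + a + 2" by simp
  ultimately show ?thesis
    unfolding diffs_def bessel_coeff_shift by (simp add: bessel_coeff_def powr_add add_ac del: of_nat_Suc)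
qed

lemma DERIV_bessel_sq: "(bessel_sq a has_real_derivative - (1/2) * bessel_sq (a + 1) u) (at u)"
proof -
  have "DERIV (\<lambda>u. \<Sum>k. bessel_coeff a k * u ^ k) u :> (\<Sum>k. diffs (bessel_coeff a) k * u ^ k)"
    by (rule termdiffs_strong[where K = "\<bar>u\<bar> + 1"]) (auto intro: summable_bessel)
  moreover have "(\<Sum>k. diffs (bessel_coeff a) k * u ^ k) = - (1/2) * bessel_sq (a + 1) u"
    using suminf_mult[OF summable_bessel[of "a + 1" u], of "- (1/2)"]
    by (simp add: diffs_bessel_coeff bessel_sq_def algebra_simps)
  ultimately show ?thesis
    by (simp add: bessel_sq_def[abs_def])
qed

lemmas DERIV_bessel_sq_chain [derivative_intros] = DERIV_chain2[OF DERIV_bessel_sq]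

lemma continuous_on_bessel_sq [continuous_intros]:
  "continuous_on S f \<Longrightarrow> continuous_on S (\<lambda>x. bessel_sq a (f x))"
  by (rule continuous_on_compose2[of UNIV "bessel_sq a"])
     (auto intro: DERIV_isCont DERIV_bessel_sq continuous_at_imp_continuous_on)

text \<open>The classical recurrence J_a + J_{a+2} = (2 (a + 1) / t) J_{a+1}, divided by t^a. With X
  = \<open>2 * bessel_coeff (a + 1) (Suc k)\<close>, the two coefficients of u^(k+1) on the left are
  (k + a + 2) X and -(k + 1) X, with sum (a + 1) X.\<close>

lemma bessel_sq_rec: "bessel_sq a u + u * bessel_sq (a + 2) u = 2 * (a + 1) * bessel_sq (a + 1) u"
proof -
  note s = summable_bessel
  have c0: "bessel_coeff a 0 = 2 * (a + 1) * bessel_coeff (a + 1) 0"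
    using rGamma_plus1[of "a + 1"] by (simp add: bessel_coeff_def powr_add field_simps)
  have c1: "bessel_coeff a (Suc k) + bessel_coeff (a + 2) k = 2 * (a + 1) * bessel_coeff (a + 1) (Suc k)" for k
  proof -
    have r: "rGamma (real k + a + 2) = (real k + a + 2) * rGamma (real k + a + 3)"
      using rGamma_plus1[of "real k + a + 2"] by (simp add: add_ac)
    have c: "bessel_coeff (a + 1) (Suc k)
        = - ((-1) ^ k * rGamma (real k + a + 3)) / (4 * real (Suc k) * (fact k * 4 ^ k * 2 powr a * 2))"
    proof -
      have "real k + (a + 1) + 2 = real k + a + 3" by simp
      then show ?thesis
        unfolding bessel_coeff_shift by (simp only: powr_add powr_one mult.assoc)
    qed
    have "bessel_coeff a (Suc k) = (real k + a + 2) * (2 * bessel_coeff (a + 1) (Suc k))"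
      unfolding c unfolding bessel_coeff_shift r by (simp add: mult_ac del: of_nat_Suc)
    moreover have "bessel_coeff (a + 2) k = - (real k + 1) * (2 * bessel_coeff (a + 1) (Suc k))"
    proof -
      have "x / (f * q * (p * 4)) = - n * (2 * (- x / (4 * n * (f * q * p * 2))))" if "n \<noteq> 0" for n x f q p :: real
        using that by (simp add: field_simps)
      moreover have "2 powr 2 = (4::real)" by simp
      moreover have "real k + (a + 2) + 1 = real k + a + 3" "real k + 1 = real (Suc k)" by simp_all
      ultimately show ?thesis
        unfolding c by (simp only: bessel_coeff_def powr_add \<open>2 powr 2 = 4\<close> of_nat_neq_0 not_False_eq_True)
    qed
    ultimately show ?thesis by (simp add: algebra_simps)
  qed
  have split: "bessel_sq b u = bessel_coeff b 0 + (\<Sum>k. bessel_coeff b (Suc k) * u ^ Suc k)" for b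
    using suminf_split_head[OF s[of b u]] by (simp add: bessel_sq_def)
  have s1: "summable (\<lambda>k. bessel_coeff b (Suc k) * u ^ Suc k)" for b
    using s[of b u] by (subst summable_Suc_iff)
  have s2: "summable (\<lambda>k. bessel_coeff b k * u ^ Suc k)" for b
    using summable_mult[OF s[of b u], of u] by (simp add: mult_ac)
  have "u * bessel_sq (a + 2) u = (\<Sum>k. bessel_coeff (a + 2) k * u ^ Suc k)"
    using suminf_mult[OF s[of "a + 2" u], of u] by (simp add: bessel_sq_def mult_ac)
  then have "bessel_sq a u + u * bessel_sq (a + 2) u = bessel_coeff a 0
      + (\<Sum>k. (bessel_coeff a (Suc k) + bessel_coeff (a + 2) k) * u ^ Suc k)"
    using suminf_add[OF s1 s2, of a "a + 2"] by (simp add: split[of a] distrib_right)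
  also have "\<dots> = 2 * (a + 1) * bessel_sq (a + 1) u"
    unfolding c0 c1 split[of "a + 1"] distrib_left mult.assoc
    using suminf_mult[OF s1, of "2 * (a + 1)" "a + 1"] by (simp only: distrib_left mult.assoc)
  finally show ?thesis .
qed

text \<open>Differentiating produces j_a, j_{a+1} and j_{a+2}; the recurrence eliminates the outer
  two and leaves -(2a + 1) j_{a+1}^2. This is the origin of the threshold -1/2.\<close>

lemma bessel_energy:
  assumes "a \<ge> -1/2" "u \<ge> 0"
  shows "(bessel_sq a u)\<^sup>2 + u * (bessel_sq (a + 1) u)\<^sup>2 \<le> (bessel_sq a 0)\<^sup>2"
proof -
  define E where "E u = (bessel_sq a u)\<^sup>2 + u * (bessel_sq (a + 1) u)\<^sup>2" for u
  have "(E has_real_derivative - (2 * a + 1) * (bessel_sq (a + 1) v)\<^sup>2) (at v)" for v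
  proof -
    let ?d = "2 * bessel_sq a v * (- (1/2) * bessel_sq (a + 1) v) + (bessel_sq (a + 1) v)\<^sup>2
       + v * (2 * bessel_sq (a + 1) v * (- (1/2) * bessel_sq (a + 2) v))"
    have "?d = (bessel_sq (a + 1) v)\<^sup>2 - bessel_sq (a + 1) v * (bessel_sq a v + v * bessel_sq (a + 2) v)"
      by (simp add: algebra_simps)
    also have "\<dots> = - (2 * a + 1) * (bessel_sq (a + 1) v)\<^sup>2"
      unfolding bessel_sq_rec by (simp add: power2_eq_square algebra_simps)
    finally have d: "?d = - (2 * a + 1) * (bessel_sq (a + 1) v)\<^sup>2" .
    have [simp]: "a + 1 + 1 = a + 2" by simp
    have "(E has_real_derivative ?d) (at v)"
      unfolding E_def by (auto intro!: derivative_eq_intros simp: algebra_simps)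
    then show ?thesis unfolding d .
  qed
  then have "E u \<le> E 0"
    using assms by (intro DERIV_nonpos_imp_nonincreasing[of 0 u E])
      (auto intro!: exI mult_nonneg_nonneg simp: mult_le_0_iff)
  then show ?thesis by (simp add: E_def)
qed

text \<open>Each bound drops one of the two squares in the energy. The second is meant for the wedge
  term, whose Bessel indices are one higher than those of the scalar terms.\<close>

lemma bessel_sq_bound:
  assumes "a \<ge> -1/2" "u \<ge> 0"
  shows "\<bar>bessel_sq a u\<bar> \<le> \<bar>bessel_sq a 0\<bar>" and "sqrt u * \<bar>bessel_sq (a + 1) u\<bar> \<le> \<bar>bessel_sq a 0\<bar>"
proof -
  note e = bessel_energy[OF assms]
  have "0 \<le> u * (bessel_sq (a + 1) u)\<^sup>2" using assms by simp
  with e have "(bessel_sq a u)\<^sup>2 \<le> (bessel_sq a 0)\<^sup>2" by linarith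
  then show "\<bar>bessel_sq a u\<bar> \<le> \<bar>bessel_sq a 0\<bar>" by (simp add: abs_le_square_iff)
  have "(sqrt u * \<bar>bessel_sq (a + 1) u\<bar>)\<^sup>2 = u * (bessel_sq (a + 1) u)\<^sup>2"
    using assms by (simp add: power_mult_distrib)
  then have "(sqrt u * \<bar>bessel_sq (a + 1) u\<bar>)\<^sup>2 \<le> (\<bar>bessel_sq a 0\<bar>)\<^sup>2"
    using e zero_le_power2[of "bessel_sq a u"] unfolding power2_abs by linarith
  then show "sqrt u * \<bar>bessel_sq (a + 1) u\<bar> \<le> \<bar>bessel_sq a 0\<bar>"
    by (rule power2_le_imp_le) simp
qed

lemma bessel_J_conv: "v > 0 \<Longrightarrow> v powr (- a) * bessel_J a v = bessel_sq a (v\<^sup>2)"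
proof -
  assume v: "v > 0"
  have eq: "(-1) ^ k / (fact k * Gamma (real k + a + 1)) * (v / 2) powr (2 * real k + a)
      = v powr a * (bessel_coeff a k * (v\<^sup>2) ^ k)" for k
  proof -
    have "(v / 2) powr (2 * real k + a) = v ^ (2 * k) * v powr a / (4 ^ k * 2 powr a)"
      using v powr_realpow[of "v / 2" "2 * k"]
      by (simp add: powr_add powr_divide power_divide power_mult)
    moreover have "e / (f * g) * (x * w / (q * p)) = w * (e * inverse g / (f * q * p) * x)" for e f g x w q p :: real
      by (simp add: divide_inverse mult_ac)
    ultimately show ?thesis
      by (simp only: bessel_coeff_def rGamma_inverse_Gamma power_mult)
  qed
  have "bessel_J a v = v powr a * bessel_sq a (v\<^sup>2)"
    unfolding bessel_J_def eq bessel_sq_def by (rule suminf_mult[OF summable_bessel])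
  then show ?thesis
    using v by (simp add: powr_minus field_simps)
qed

lemma bessel_J_tilde_conv: "t \<ge> 0 \<Longrightarrow> bessel_J_tilde a t = bessel_sq a (t\<^sup>2)"
proof (cases "t = 0")
  case True
  \<comment> \<open>The value at 0 is defined as a right-hand limit, so it is read off from the
    continuity of the entire function.\<close>
  have "isCont (\<lambda>v. bessel_sq a (v\<^sup>2)) 0"
    by (intro continuous_on_interior[of UNIV] continuous_intros) auto
  then have "((\<lambda>v. bessel_sq a (v\<^sup>2)) \<longlongrightarrow> bessel_sq a (0\<^sup>2)) (at_right 0)"
    by (auto simp: isCont_def filterlim_at_split)
  moreover have "\<forall>\<^sub>F v in at_right 0. bessel_sq a (v\<^sup>2) = v powr (- a) * bessel_J a v"
    by (auto simp: bessel_J_conv eventually_at_right_less intro: eventually_mono[OF eventually_at_right_less])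
  ultimately have "((\<lambda>v. v powr (- a) * bessel_J a v) \<longlongrightarrow> bessel_sq a (0\<^sup>2)) (at_right 0)"
    by (rule Lim_transform_eventually)
  then show ?thesis
    using True by (simp add: bessel_J_tilde_def tendsto_Lim)
qed (simp add: bessel_J_tilde_def bessel_J_conv)

section \<open>An Appell family built from Bessel functions\<close>

text \<open>Integer indices make the power vanish below degree 0, so that differentiation is a plain index shift.\<close>

definition dpow :: "int \<Rightarrow> real \<Rightarrow> real" where
  "dpow n s = (if n < 0 then 0 else s ^ nat n / fact (nat n))"

lemma DERIV_dpow: "(dpow n has_real_derivative dpow (n - 1) s) (at s)"
proof (cases "n > 0")
  case True
  then obtain k where k: "n = int (Suc k)" by (intro that[of "nat (n - 1)"]) simp
  have [simp]: "nat (1 + int k) = Suc k" by simp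
  have "((\<lambda>s::real. s ^ Suc k / fact (Suc k)) has_real_derivative s ^ k / fact k) (at s)"
    using DERIV_cdivide[OF DERIV_pow[of "Suc k" s], of "fact (Suc k)"] by (simp del: of_nat_Suc)
  moreover have "dpow n = (\<lambda>s. s ^ Suc k / fact (Suc k))" "dpow (n - 1) s = s ^ k / fact k"
    by (auto simp: k dpow_def fun_eq_iff simp del: fact_Suc)
  ultimately show ?thesis by simp
next
  case False
  then have "dpow n = (\<lambda>s. if n = 0 then 1 else 0)" "dpow (n - 1) s = 0"
    by (auto simp: dpow_def fun_eq_iff)
  then show ?thesis by simp
qed

lemmas DERIV_dpow_chain [derivative_intros] = DERIV_chain2[OF DERIV_dpow]

lemma continuous_on_dpow [continuous_intros]:
  "continuous_on S f \<Longrightarrow> continuous_on S (\<lambda>x. dpow n (f x))"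
  by (cases "n < 0") (auto simp: dpow_def intro!: continuous_intros)

text \<open>The weights are those of the Hermite polynomials divided by m!. The truncation M is kept
  apart from m so that differentiation changes m but not the range of summation; terms with 2l > m
  vanish through \<open>dpow\<close>.\<close>

definition bessel_appell :: "nat \<Rightarrow> int \<Rightarrow> real \<Rightarrow> real \<Rightarrow> real \<Rightarrow> real" where
  "bessel_appell M m b s u = (\<Sum>l\<le>M. dpow (m - 2 * int l) s / (2 ^ l * fact l) * bessel_sq (b - real l) u)"

lemma continuous_on_bessel_appell [continuous_intros]:
  "continuous_on S f \<Longrightarrow> continuous_on S h \<Longrightarrow> continuous_on S (\<lambda>x. bessel_appell M m b (f x) (h x))"
  unfolding bessel_appell_def by (intro continuous_intros) auto

text \<open>The Appell property: the derivative in s acts on \<open>dpow\<close> alone and the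
  derivative in u on \<open>bessel_sq\<close> alone, and both merely shift an index without touching
  the weights. The derivative is passed as a free D so that the rule can be chained.\<close>

lemma DERIV_bessel_appell [derivative_intros]:
  assumes "(f has_real_derivative f') (at r)" "(h has_real_derivative h') (at r)"
    and "D = bessel_appell M (m - 1) b (f r) (h r) * f' - bessel_appell M m (b + 1) (f r) (h r) / 2 * h'"
  shows "((\<lambda>r. bessel_appell M m b (f r) (h r)) has_real_derivative D) (at r)"
proof -
  have "((\<lambda>r. dpow (m - 2 * int l) (f r) / (2 ^ l * fact l) * bessel_sq (b - real l) (h r)) has_real_derivative
     (dpow (m - 1 - 2 * int l) (f r) / (2 ^ l * fact l) * bessel_sq (b - real l) (h r) * f'
     - dpow (m - 2 * int l) (f r) / (2 ^ l * fact l) * bessel_sq (b + 1 - real l) (h r) / 2 * h')) (at r)" for l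
  proof -
    have [simp]: "m - 2 * int l - 1 = m - 1 - 2 * int l" "b - real l + 1 = b + 1 - real l" by auto
    show ?thesis
      by (rule derivative_eq_intros assms refl | simp add: field_simps)+
  qed
  from DERIV_sum[of "{..M}", OF this] show ?thesis
    unfolding assms(3) bessel_appell_def
    by (simp add: sum_subtractf sum_distrib_right sum_divide_distrib)
qed

text \<open>The left side is the Laplacian, written in s and u and divided by |y|^2. The recurrence
  at index b - l turns the part of degree m into multiples -2l of j_{b+1-l}; the factor l cancels
  against 2^l l!, and shifting l by one produces the family member of degree m - 2, with opposite
  sign.\<close>

lemma bessel_appell_pde:
  assumes "m < 2 * int M + 2"
  shows "bessel_appell M (m - 2) b s u + u * bessel_appell M m (b + 2) s u
     - 2 * (b + 1) * bessel_appell M m (b + 1) s u = - bessel_appell M m b s u"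
proof -
  define c where "c l = dpow (m - 2 * int l) s / (2 ^ l * fact l)" for l
  have 1: "u * bessel_sq (b + 2 - real l) u - 2 * (b + 1) * bessel_sq (b + 1 - real l) u + bessel_sq (b - real l) u
      = - 2 * real l * bessel_sq (b + 1 - real l) u" for l
    using bessel_sq_rec[of "b - real l" u] by (simp add: algebra_simps)
  have "u * bessel_appell M m (b + 2) s u - 2 * (b + 1) * bessel_appell M m (b + 1) s u + bessel_appell M m b s u
     = (\<Sum>l\<le>M. c l * (u * bessel_sq (b + 2 - real l) u - 2 * (b + 1) * bessel_sq (b + 1 - real l) u
         + bessel_sq (b - real l) u))"
    unfolding bessel_appell_def c_def[symmetric] sum_distrib_left
    by (simp add: algebra_simps flip: sum.distrib sum_subtractf)
  also have "\<dots> = (\<Sum>l\<le>M. - 2 * real l * c l * bessel_sq (b + 1 - real l) u)"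
    unfolding 1 by (simp add: mult_ac)
  \<comment> \<open>The term l = 0 carries the factor l and disappears, so the sum can be reindexed
    by \<open>Suc l\<close>.\<close>
  also have "\<dots> = (\<Sum>l<M. - 2 * real (Suc l) * c (Suc l) * bessel_sq (b - real l) u)"
    by (subst lessThan_Suc_atMost[symmetric], subst sum.lessThan_Suc_shift) simp
  also have "\<dots> = - (\<Sum>l<M. dpow (m - 2 - 2 * int l) s / (2 ^ l * fact l) * bessel_sq (b - real l) u)"
  proof (subst sum_negf[symmetric], rule sum.cong)
    fix l
    have "- 2 * n * (x / (2 * q * (n * f))) * y = - (x / (q * f) * y)" if "n \<noteq> 0" for n x q f y :: real
      using that by simp
    moreover have "m - 2 * int (Suc l) = m - 2 - 2 * int l" by simp
    ultimately show "- 2 * real (Suc l) * c (Suc l) * bessel_sq (b - real l) u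
        = - (dpow (m - 2 - 2 * int l) s / (2 ^ l * fact l) * bessel_sq (b - real l) u)"
      unfolding c_def power_Suc fact_Suc of_nat_mult by (simp only: of_nat_fact of_nat_neq_0 not_False_eq_True)
  qed simp
  \<comment> \<open>The missing term l = M has exponent m - 2 - 2M < 0 by assumption, so
    \<open>dpow\<close> makes it zero.\<close>
  also have "(\<Sum>l<M. dpow (m - 2 - 2 * int l) s / (2 ^ l * fact l) * bessel_sq (b - real l) u)
     = bessel_appell M (m - 2) b s u"
    using assms unfolding bessel_appell_def
    by (subst lessThan_Suc_atMost[symmetric]) (simp add: dpow_def)
  finally show ?thesis by simp
qed

lemma dpow_bound:
  assumes "1 \<le> P" "\<bar>s\<bar> \<le> P" "n \<le> int N"
  shows "\<bar>dpow n s\<bar> \<le> P ^ N"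
proof (cases "n < 0")
  case False
  have "\<bar>dpow n s\<bar> \<le> \<bar>s\<bar> ^ nat n / 1"
    using False by (simp add: dpow_def power_abs del: div_by_1) (intro frac_le, auto)
  also have "\<dots> \<le> P ^ nat n" using assms by (simp add: power_mono)
  also have "\<dots> \<le> P ^ N" using assms False by (intro power_increasing) auto
  finally show ?thesis .
qed (use assms in \<open>simp add: dpow_def\<close>)

text \<open>The weight w is 1 for the scalar terms and the square root of the Gram determinant for
  the wedge term. Bessel bounds are asked only where \<open>dpow\<close> does not vanish; elsewhere
  B l is arbitrary, hence the absolute values in the sum.\<close>

lemma bessel_appell_weighted_bound:
  assumes j: "\<And>l. 2 * int l \<le> m \<Longrightarrow> w * \<bar>bessel_sq (b - real l) u\<bar> \<le> B l"
    and w: "w \<ge> 0" and P: "1 \<le> P" "\<bar>s\<bar> \<le> P" and m: "m \<le> int N"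
  shows "w * \<bar>bessel_appell M m b s u\<bar> \<le> (\<Sum>l\<le>M. \<bar>B l\<bar>) * P ^ N"
proof -
  have "w * \<bar>bessel_appell M m b s u\<bar>
      \<le> w * (\<Sum>l\<le>M. \<bar>dpow (m - 2 * int l) s / (2 ^ l * fact l) * bessel_sq (b - real l) u\<bar>)"
    unfolding bessel_appell_def by (intro mult_left_mono sum_abs w)
  also have "\<dots> = (\<Sum>l\<le>M. w * \<bar>dpow (m - 2 * int l) s / (2 ^ l * fact l) * bessel_sq (b - real l) u\<bar>)"
    by (rule sum_distrib_left)
  also have "\<dots> \<le> (\<Sum>l\<le>M. \<bar>B l\<bar> * P ^ N)"
  proof (rule sum_mono)
    fix l
    show "w * \<bar>dpow (m - 2 * int l) s / (2 ^ l * fact l) * bessel_sq (b - real l) u\<bar> \<le> \<bar>B l\<bar> * P ^ N"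
    proof (cases "2 * int l \<le> m")
      case True
      have one: "1 \<le> (2::real) ^ l * fact l"
        using mult_mono[of 1 "2 ^ l" 1 "fact l :: real"] by simp
      have "\<bar>dpow (m - 2 * int l) s / (2 ^ l * fact l)\<bar> \<le> \<bar>dpow (m - 2 * int l) s\<bar> / 1"
        unfolding abs_divide using one by (intro frac_le) auto
      also have "\<dots> \<le> P ^ N" using dpow_bound[OF P, of "m - 2 * int l" N] m by simp
      finally have "\<bar>dpow (m - 2 * int l) s / (2 ^ l * fact l)\<bar> * (w * \<bar>bessel_sq (b - real l) u\<bar>) \<le> P ^ N * \<bar>B l\<bar>"
        using j[OF True] w P by (intro mult_mono) auto
      then show ?thesis by (simp add: abs_mult mult_ac)
    qed (use P in \<open>simp add: dpow_def\<close>)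
  qed
  finally show ?thesis by (simp add: sum_distrib_right)
qed

section \<open>Integration by parts against rapidly decreasing functions\<close>

lemma integrable_inverse_one_plus_square: "integrable lborel (\<lambda>t::real. inverse (1 + t\<^sup>2))"
proof -
  have "set_integrable lborel (einterval (-\<infinity>) \<infinity>) (\<lambda>t::real. inverse (1 + t\<^sup>2))"
  proof (rule interval_integral_FTC_nonneg(1)[where F = arctan])
    show "((arctan \<circ> real_of_ereal) \<longlongrightarrow> - (pi / 2)) (at_right (-\<infinity>))"
      "((arctan \<circ> real_of_ereal) \<longlongrightarrow> pi / 2) (at_left \<infinity>)"
      unfolding ereal_tendsto_simps using tendsto_arctan_at_bot tendsto_arctan_at_top by simp_all
    show "isCont (\<lambda>t::real. inverse (1 + t\<^sup>2)) t" for t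
      by (rule continuous_intros | simp add: add_nonneg_eq_0_iff)+
  qed (auto intro!: DERIV_arctan)
  then show ?thesis by (simp add: set_integrable_def)
qed

text \<open>The exponent is chosen for a product comparison: each 1 + (x . b)^2 is at most (1 +
  |x|)^2, so the function lies below a product of one-dimensional functions 1/(1 + t^2).\<close>

lemma integrable_inverse_one_plus_norm_power:
  "integrable lborel (\<lambda>x::'a::euclidean_space. 1 / (1 + norm x) ^ (2 * DIM('a)))"
proof (rule Bochner_Integration.integrable_bound)
  let ?f = "\<lambda>t::real. inverse (1 + t\<^sup>2)"
  show "integrable lborel (\<lambda>x::'a. \<Prod>b\<in>Basis. ?f (x \<bullet> b))"
  proof (rule integrableI_nonneg)
    have 1: "(\<integral>\<^sup>+t. ennreal (?f t) \<partial>lborel) < \<infinity>"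
      using integrable_inverse_one_plus_square by (simp add: integrable_iff_bounded)
    have "(\<integral>\<^sup>+x. ennreal (\<Prod>b\<in>(Basis::'a set). ?f (x \<bullet> b)) \<partial>lborel)
        = (\<integral>\<^sup>+x. (\<Prod>b\<in>(Basis::'a set). ennreal (?f (x \<bullet> b))) \<partial>lborel)"
      by (simp add: prod_ennreal)
    also have "\<dots> = (\<Prod>b\<in>(Basis::'a set). (\<integral>\<^sup>+t. ennreal (?f t) \<partial>lborel))"
      by (rule nn_integral_lborel_prod) auto
    also have "\<dots> < \<infinity>"
      using 1 by (simp add: ennreal_prod_eq_top less_top power_less_top_ennreal)
    finally show "(\<integral>\<^sup>+x. ennreal (\<Prod>b\<in>(Basis::'a set). ?f (x \<bullet> b)) \<partial>lborel) < \<infinity>" .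
  qed (auto intro!: prod_nonneg)
  show "AE x::'a in lborel. norm (1 / (1 + norm x) ^ (2 * DIM('a))) \<le> norm (\<Prod>b\<in>Basis. ?f (x \<bullet> b))"
  proof (rule AE_I2)
    fix x :: 'a
    have "(\<Prod>b\<in>Basis. 1 + (x \<bullet> b)\<^sup>2) \<le> (\<Prod>b\<in>(Basis::'a set). (1 + norm x)\<^sup>2)"
    proof (rule prod_mono, intro conjI)
      fix b :: 'a assume "b \<in> Basis"
      then have "(x \<bullet> b)\<^sup>2 \<le> (norm x)\<^sup>2"
        by (metis Basis_le_norm abs_le_square_iff abs_norm_cancel)
      then show "1 + (x \<bullet> b)\<^sup>2 \<le> (1 + norm x)\<^sup>2" using norm_ge_zero[of x] by (simp add: power2_sum del: norm_ge_zero)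
    qed simp
    then have "(\<Prod>b\<in>Basis. 1 + (x \<bullet> b)\<^sup>2) \<le> (1 + norm x) ^ (2 * DIM('a))"
      by (simp add: power_mult)
    moreover have "0 < (\<Prod>b\<in>Basis. 1 + (x \<bullet> b)\<^sup>2)"
      by (intro prod_pos) (auto simp: add_pos_nonneg)
    ultimately have "1 / (1 + norm x) ^ (2 * DIM('a)) \<le> 1 / (\<Prod>b\<in>Basis. 1 + (x \<bullet> b)\<^sup>2)"
      by (intro divide_left_mono) auto
    then show "norm (1 / (1 + norm x) ^ (2 * DIM('a))) \<le> norm (\<Prod>b\<in>Basis. ?f (x \<bullet> b))"
      by (simp add: abs_prod divide_inverse prod_inversef[symmetric] add_nonneg_nonneg abs_of_nonneg prod_nonneg)
  qed
qed simp

lemma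
  fixes f :: "'a::euclidean_space \<Rightarrow> 'b::{banach, second_countable_topology}"
  assumes [measurable]: "f \<in> borel_measurable borel"
  shows integrable_lborel_translate: "integrable lborel (\<lambda>x. f (x + c)) \<longleftrightarrow> integrable lborel f"
    and integral_lborel_translate: "(\<integral>x. f (x + c) \<partial>lborel) = (\<integral>x. f x \<partial>lborel)"
proof -
  have "distr lborel borel (\<lambda>x. x + c) = lborel"
    using lborel_distr_plus[of c] by (subst add.commute)
  then show "integrable lborel (\<lambda>x. f (x + c)) \<longleftrightarrow> integrable lborel f"
    and "(\<integral>x. f (x + c) \<partial>lborel) = (\<integral>x. f x \<partial>lborel)"
    using integrable_distr_eq[of "\<lambda>x. x + c" lborel borel f] integral_distr[of "\<lambda>x. x + c" lborel borel f]
    by simp_all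
qed

section \<open>Functions of polynomial growth and of rapid decay\<close>

definition tempered :: "('a::euclidean_space \<Rightarrow> 'b::{real_normed_vector, second_countable_topology}) \<Rightarrow> bool" where
  "tempered f \<longleftrightarrow> f \<in> borel_measurable borel \<and> (\<exists>C N. \<forall>x. norm (f x) \<le> C * (1 + norm x) ^ N)"

text \<open>Decay without any condition on derivatives. This is stable under multiplication by
  kernels and their derivatives, about which only polynomial growth is recorded.\<close>

definition rapid :: "('a::euclidean_space \<Rightarrow> 'b::{real_normed_vector, second_countable_topology}) \<Rightarrow> bool" where
  "rapid f \<longleftrightarrow> f \<in> borel_measurable borel \<and> (\<forall>N. \<exists>C. \<forall>x. (1 + norm x) ^ N * norm (f x) \<le> C)"

lemma temperedE:
  assumes "tempered f"
  obtains C N where "C \<ge> 0" "\<And>x. norm (f x) \<le> C * (1 + norm x) ^ N"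
proof -
  obtain C N where C: "\<And>x. norm (f x) \<le> C * (1 + norm x) ^ N"
    using assms by (auto simp: tempered_def)
  have "0 \<le> C" using order_trans[OF norm_ge_zero C[of 0]] by simp
  then show ?thesis using C by (rule that)
qed

lemma tempered_const [simp]: "tempered (\<lambda>x. c)"
  unfolding tempered_def by (intro conjI exI[of _ "norm c"] exI[of _ 0]) auto

lemma tempered_linear:
  assumes "bounded_linear f" shows "tempered f"
proof -
  obtain K where K: "\<And>x. norm (f x) \<le> norm x * K" "K > 0"
    using bounded_linear.pos_bounded[OF assms] by blast
  have "norm (f x) \<le> K * (1 + norm x) ^ 1" for x
    using K(1)[of x] K(2) by (simp add: algebra_simps)
  moreover have "f \<in> borel_measurable borel"
    using assms by (intro borel_measurable_continuous_onI linear_continuous_on)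
  ultimately show ?thesis unfolding tempered_def by blast
qed

lemma tempered_bilinear:
  assumes "bounded_bilinear h" "tempered f" "tempered g"
  shows "tempered (\<lambda>x. h (f x) (g x))"
proof -
  obtain C N where C: "C \<ge> 0" "\<And>x. norm (f x) \<le> C * (1 + norm x) ^ N" using assms(2) by (rule temperedE) blast
  obtain D M where D: "D \<ge> 0" "\<And>x. norm (g x) \<le> D * (1 + norm x) ^ M" using assms(3) by (rule temperedE) blast
  obtain K where K: "K \<ge> 0" "\<And>a b. norm (h a b) \<le> norm a * norm b * K"
    using bounded_bilinear.nonneg_bounded[OF assms(1)] by blast
  have "norm (h (f x) (g x)) \<le> (C * D * K) * (1 + norm x) ^ (N + M)" for x
  proof -
    have "norm (h (f x) (g x)) \<le> (C * (1 + norm x) ^ N) * (D * (1 + norm x) ^ M) * K"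
      using C D K by (intro order_trans[OF K(2)] mult_right_mono mult_mono) auto
    then show ?thesis by (simp add: power_add mult_ac)
  qed
  moreover have "(\<lambda>x. h (f x) (g x)) \<in> borel_measurable borel"
  proof (rule borel_measurable_continuous_Pair[where H = h])
    show "continuous_on UNIV (\<lambda>x. h (fst x) (snd x))"
      by (intro bounded_bilinear.continuous_on[OF assms(1)] continuous_on_fst continuous_on_snd continuous_on_id)
  qed (use assms in \<open>auto simp: tempered_def\<close>)
  ultimately show ?thesis unfolding tempered_def by blast
qed

lemma tempered_add:
  assumes "tempered f" "tempered g"
  shows "tempered (\<lambda>x. f x + g x)"
proof -
  obtain C N where C: "C \<ge> 0" "\<And>x. norm (f x) \<le> C * (1 + norm x) ^ N" using assms(1) by (rule temperedE) blast
  obtain D M where D: "D \<ge> 0" "\<And>x. norm (g x) \<le> D * (1 + norm x) ^ M" using assms(2) by (rule temperedE) blast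
  have "norm (f x + g x) \<le> (C + D) * (1 + norm x) ^ (N + M)" for x
  proof -
    have "norm (f x + g x) \<le> C * (1 + norm x) ^ N + D * (1 + norm x) ^ M"
      using norm_triangle_ineq[of "f x" "g x"] C(2)[of x] D(2)[of x] by linarith
    also have "\<dots> \<le> C * (1 + norm x) ^ (N + M) + D * (1 + norm x) ^ (N + M)"
      using C(1) D(1) by (intro add_mono mult_left_mono power_increasing) auto
    finally show ?thesis by (simp add: distrib_right)
  qed
  moreover have "(\<lambda>x. f x + g x) \<in> borel_measurable borel"
    using assms by (auto simp: tempered_def)
  ultimately show ?thesis unfolding tempered_def by blast
qed

lemmas tempered_scaleR = tempered_bilinear[OF bounded_bilinear_scaleR]
lemmas tempered_mult = tempered_bilinear[OF bounded_bilinear_mult]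

lemma tempered_minus: "tempered f \<Longrightarrow> tempered (\<lambda>x. - f x)"
  using tempered_scaleR[OF tempered_const[of "-1"], of f] by simp

lemma tempered_diff: "tempered f \<Longrightarrow> tempered g \<Longrightarrow> tempered (\<lambda>x. f x - g x)"
  using tempered_add[OF _ tempered_minus[of g], of f] by simp

lemma tempered_power: "tempered f \<Longrightarrow> tempered (\<lambda>x. f x ^ k :: real)"
  by (induction k) (auto intro: tempered_mult)

lemma tempered_sum: "(\<And>i. i \<in> I \<Longrightarrow> tempered (f i)) \<Longrightarrow> tempered (\<lambda>x. \<Sum>i\<in>I. f i x)"
  by (induction I rule: infinite_finite_induct) (auto intro: tempered_add)

lemmas tempered_intros = tempered_const tempered_add tempered_diff tempered_minus tempered_mult
  tempered_scaleR tempered_power tempered_sum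

lemma rapidE:
  assumes "rapid f"
  obtains C where "C \<ge> 0" "\<And>x. (1 + norm x) ^ N * norm (f x) \<le> C"
proof -
  obtain C where C: "\<And>x. (1 + norm x) ^ N * norm (f x) \<le> C"
    using assms unfolding rapid_def by blast
  have "0 \<le> C" by (rule order_trans[OF _ C[of 0]]) simp
  then show ?thesis using C by (rule that)
qed

text \<open>Decay of order M of the product uses decay of order M + N of g, where N is the growth
  order of f. A general bilinear map covers real, scalar and Clifford products at once.\<close>

lemma rapid_bilinear:
  assumes "bounded_bilinear h" "tempered f" "rapid g"
  shows "rapid (\<lambda>x. h (f x) (g x))"
proof -
  obtain C N where C: "C \<ge> 0" "\<And>x. norm (f x) \<le> C * (1 + norm x) ^ N" using assms(2) by (rule temperedE) blast
  obtain K where K: "K \<ge> 0" "\<And>a b. norm (h a b) \<le> norm a * norm b * K"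
    using bounded_bilinear.nonneg_bounded[OF assms(1)] by blast
  have "\<exists>B. \<forall>x. (1 + norm x) ^ M * norm (h (f x) (g x)) \<le> B" for M
  proof -
    obtain D where D: "D \<ge> 0" "\<And>x. (1 + norm x) ^ (M + N) * norm (g x) \<le> D"
      using assms(3) by (rule rapidE) blast
    have "(1 + norm x) ^ M * norm (h (f x) (g x)) \<le> C * K * D" for x
    proof -
      have "(1 + norm x) ^ M * norm (h (f x) (g x))
          \<le> (1 + norm x) ^ M * ((C * (1 + norm x) ^ N) * norm (g x) * K)"
        using C K by (intro mult_left_mono order_trans[OF K(2)] mult_right_mono) auto
      also have "\<dots> = C * K * ((1 + norm x) ^ (M + N) * norm (g x))"
        by (simp add: power_add mult_ac)
      also have "\<dots> \<le> C * K * D"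
        using D C K by (intro mult_left_mono) auto
      finally show ?thesis .
    qed
    then show ?thesis by blast
  qed
  moreover have "(\<lambda>x. h (f x) (g x)) \<in> borel_measurable borel"
  proof (rule borel_measurable_continuous_Pair[where H = h])
    show "continuous_on UNIV (\<lambda>x. h (fst x) (snd x))"
      by (intro bounded_bilinear.continuous_on[OF assms(1)] continuous_on_fst continuous_on_snd continuous_on_id)
  qed (use assms in \<open>auto simp: tempered_def rapid_def\<close>)
  ultimately show ?thesis unfolding rapid_def by blast
qed

lemma rapid_diff:
  assumes "rapid f" "rapid g"
  shows "rapid (\<lambda>x. f x - g x)"
proof -
  have "\<exists>B. \<forall>x. (1 + norm x) ^ M * norm (f x - g x) \<le> B" for M
  proof -
    obtain C where C: "C \<ge> 0" "\<And>x. (1 + norm x) ^ M * norm (f x) \<le> C" using assms(1) by (rule rapidE) blast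
    obtain D where D: "D \<ge> 0" "\<And>x. (1 + norm x) ^ M * norm (g x) \<le> D" using assms(2) by (rule rapidE) blast
    have "(1 + norm x) ^ M * norm (f x - g x) \<le> (1 + norm x) ^ M * (norm (f x) + norm (g x))" for x
      by (intro mult_left_mono norm_triangle_ineq4) auto
    then have "(1 + norm x) ^ M * norm (f x - g x) \<le> C + D" for x
      using C(2)[of x] D(2)[of x] by (smt (verit) distrib_left)
    then show ?thesis by blast
  qed
  moreover have "(\<lambda>x. f x - g x) \<in> borel_measurable borel"
    using assms by (auto simp: rapid_def)
  ultimately show ?thesis unfolding rapid_def by blast
qed

lemma rapid_integrable:
  fixes f :: "'a::euclidean_space \<Rightarrow> 'b::{banach, second_countable_topology}"
  assumes "rapid f" shows "integrable lborel f"
proof -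
  obtain C where C: "C \<ge> 0" "\<And>x. (1 + norm x) ^ (2 * DIM('a)) * norm (f x) \<le> C"
    using assms by (rule rapidE) blast
  show ?thesis
  proof (rule Bochner_Integration.integrable_bound)
    show "integrable lborel (\<lambda>x::'a. C * (1 / (1 + norm x) ^ (2 * DIM('a))))"
      by (intro integrable_mult_right integrable_inverse_one_plus_norm_power)
    show "f \<in> borel_measurable lborel" using assms by (simp add: rapid_def)
    show "AE x in lborel. norm (f x) \<le> norm (C * (1 / (1 + norm x) ^ (2 * DIM('a))))"
    proof (rule AE_I2)
      fix x :: 'a
      have "0 < (1 + norm x) ^ (2 * DIM('a))" by (intro zero_less_power) (simp add: add_pos_nonneg)
      then have "norm (f x) \<le> C / (1 + norm x) ^ (2 * DIM('a))"
        using C(2)[of x] by (simp add: pos_le_divide_eq mult.commute)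
      then show "norm (f x) \<le> norm (C * (1 / (1 + norm x) ^ (2 * DIM('a))))"
        using C(1) by simp
    qed
  qed
qed

section \<open>Directional derivatives and their integrals\<close>

definition has_pd ::
    "'a::real_normed_vector \<Rightarrow> ('a \<Rightarrow> 'b::real_normed_vector) \<Rightarrow> ('a \<Rightarrow> 'b) \<Rightarrow> bool" where
  "has_pd e f f' \<longleftrightarrow> (\<forall>x. ((\<lambda>r. f (x + r *\<^sub>R e)) has_vector_derivative f' x) (at 0))"

text \<open>\<open>has_pd\<close> speaks only of the parameter value 0, but at every base point, so
  moving the base point along the line gives every other parameter value.\<close>

lemma has_pd_line:
  assumes "has_pd e f f'"
  shows "((\<lambda>r. f (x + r *\<^sub>R e)) has_vector_derivative f' (x + r *\<^sub>R e)) (at r)"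
proof -
  have "((\<lambda>\<rho>. f ((x + r *\<^sub>R e) + \<rho> *\<^sub>R e)) \<circ> (\<lambda>\<rho>. \<rho> - r) has_vector_derivative 1 *\<^sub>R f' (x + r *\<^sub>R e)) (at r)"
    using assms by (intro vector_diff_chain_at) (auto simp: has_pd_def intro!: derivative_eq_intros)
  then show ?thesis by (simp add: o_def algebra_simps)
qed

text \<open>By translation invariance every difference quotient of h has integral zero, and
  dominated convergence passes to the limit. Neither Fubini nor continuity of h' is involved, and h'
  inherits measurability as a pointwise limit.\<close>

lemma integral_partial_derivative_eq_0:
  fixes h :: "'a::euclidean_space \<Rightarrow> 'b::{banach, second_countable_topology}"
  assumes pd: "has_pd e h h'" and e: "norm e \<le> 1" and h: "rapid h"
    and bd: "\<And>x. (1 + norm x) ^ (2 * DIM('a)) * norm (h' x) \<le> C"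
  shows "(\<integral>x. h' x \<partial>lborel) = 0"
proof -
  define N where "N = 2 * DIM('a)"
  define \<epsilon> where "\<epsilon> n = inverse (real (Suc n))" for n
  define q where "q n x = (h (x + \<epsilon> n *\<^sub>R e) - h x) /\<^sub>R \<epsilon> n" for n x
  have \<epsilon>: "0 < \<epsilon> n" "\<epsilon> n \<le> 1" for n by (auto simp: \<epsilon>_def divide_simps)
  have [measurable]: "h \<in> borel_measurable borel" using h by (simp add: rapid_def)
  have qm [measurable]: "q n \<in> borel_measurable borel" for n unfolding q_def by measurable
  have lim: "(\<lambda>n. q n x) \<longlonglongrightarrow> h' x" for x
  proof -
    have "((\<lambda>r. (h (x + r *\<^sub>R e) - h x) /\<^sub>R r) \<longlongrightarrow> h' x) (at 0)"
    proof (rule LIM_zero_cancel, rule tendsto_norm_zero_cancel, rule Lim_transform_eventually)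
      show "((\<lambda>r. norm (h (x + r *\<^sub>R e) - h x - r *\<^sub>R h' x) / norm r) \<longlongrightarrow> 0) (at 0)"
        using pd by (auto simp: has_pd_def has_vector_derivative_def has_derivative_at dest!: spec[of _ x])
      have "norm (a - r *\<^sub>R b) / norm r = norm (a /\<^sub>R r - b)" if "r \<noteq> 0" for a b :: 'b and r :: real
      proof -
        have "a /\<^sub>R r - b = (a - r *\<^sub>R b) /\<^sub>R r" using that by (simp add: scaleR_diff_right)
        then show ?thesis by (simp add: divide_inverse_commute)
      qed
      then show "\<forall>\<^sub>F r in at 0. norm (h (x + r *\<^sub>R e) - h x - r *\<^sub>R h' x) / norm r
          = norm ((h (x + r *\<^sub>R e) - h x) /\<^sub>R r - h' x)"
        by (auto simp: eventually_at_filter)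
    qed
    moreover have "filterlim \<epsilon> (at 0) sequentially"
      unfolding filterlim_at \<epsilon>_def[abs_def] using LIMSEQ_inverse_real_of_nat by auto
    ultimately show ?thesis
      unfolding q_def by (rule filterlim_compose)
  qed
  have h'm: "h' \<in> borel_measurable borel"
    by (rule borel_measurable_LIMSEQ_metric[OF qm lim])
  \<comment> \<open>The dominating function comes from the mean value inequality. Along a segment of
    length at most 1, 1 + |x| is at most twice 1 + |x + r e|, which costs the factor 2^N.\<close>
  have q_bd: "norm (q n x) \<le> 2 ^ N * C * (1 / (1 + norm x) ^ N)" for n x
  proof -
    define B where "B = 2 ^ N * C * (1 / (1 + norm x) ^ N)"
    have "norm (h' (x + r *\<^sub>R e)) \<le> B" if r: "r \<in> {0..\<epsilon> n}" for r
    proof -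
      have "norm (r *\<^sub>R e) \<le> 1" using r \<epsilon>[of n] e by (auto intro!: mult_le_one)
      moreover have "norm x \<le> norm (x + r *\<^sub>R e) + norm (r *\<^sub>R e)"
        using norm_triangle_ineq4[of "x + r *\<^sub>R e" "r *\<^sub>R e"] by simp
      moreover have "1 + a \<le> 2 * (1 + b)" if "c \<le> 1" "a \<le> b + c" "0 \<le> b" for a b c :: real
        using that by argo
      ultimately have "1 + norm x \<le> 2 * (1 + norm (x + r *\<^sub>R e))"
        by (meson norm_ge_zero)
      then have "(1 + norm x) ^ N \<le> (2 * (1 + norm (x + r *\<^sub>R e))) ^ N"
        by (intro power_mono) auto
      then have "(1 + norm x) ^ N * norm (h' (x + r *\<^sub>R e))
          \<le> 2 ^ N * ((1 + norm (x + r *\<^sub>R e)) ^ N * norm (h' (x + r *\<^sub>R e)))"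
        by (metis mult.assoc mult_right_mono norm_ge_zero power_mult_distrib)
      also have "\<dots> \<le> 2 ^ N * C"
        using bd[of "x + r *\<^sub>R e"] by (intro mult_left_mono) (auto simp: N_def)
      finally have "(1 + norm x) ^ N * norm (h' (x + r *\<^sub>R e)) \<le> 2 ^ N * C" .
      moreover have "0 < (1 + norm x) ^ N" by (intro zero_less_power) (simp add: add_pos_nonneg)
      ultimately show ?thesis by (simp add: B_def pos_le_divide_eq mult.commute)
    qed
    then have ob: "onorm (\<lambda>t. t *\<^sub>R h' (x + r *\<^sub>R e)) \<le> B" if "r \<in> {0..\<epsilon> n}" for r
    proof (intro onorm_le)
      fix t :: real
      show "norm (t *\<^sub>R h' (x + r *\<^sub>R e)) \<le> B * norm t"
        using mult_left_mono[OF \<open>\<And>r. r \<in> {0..\<epsilon> n} \<Longrightarrow> norm (h' (x + r *\<^sub>R e)) \<le> B\<close>[OF that], of "\<bar>t\<bar>"]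
        by (simp add: mult.commute)
    qed
    have der: "((\<lambda>r. h (x + r *\<^sub>R e)) has_derivative (\<lambda>t. t *\<^sub>R h' (x + r *\<^sub>R e))) (at r within {0..\<epsilon> n})" for r
      using has_pd_line[OF pd, of x r] unfolding has_vector_derivative_def by (rule has_derivative_at_withinI)
    have "norm (h (x + \<epsilon> n *\<^sub>R e) - h (x + 0 *\<^sub>R e)) \<le> B * norm (\<epsilon> n - 0)"
      by (rule differentiable_bound[OF _ der ob]) (use \<epsilon>(1)[of n] in auto)
    then have "norm (h (x + \<epsilon> n *\<^sub>R e) - h x) \<le> B * \<epsilon> n"
      using \<epsilon>(1)[of n] by simp
    moreover have "norm (q n x) = norm (h (x + \<epsilon> n *\<^sub>R e) - h x) / \<epsilon> n"
      using \<epsilon>(1)[of n] by (simp add: q_def divide_inverse_commute)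
    ultimately show ?thesis
      using \<epsilon>(1)[of n] unfolding B_def[symmetric] by (simp only: pos_divide_le_eq)
  qed
  have w: "integrable lborel (\<lambda>x::'a. 2 ^ N * C * (1 / (1 + norm x) ^ N))"
    unfolding N_def by (intro integrable_mult_right integrable_inverse_one_plus_norm_power)
  have hi: "integrable lborel h" using h by (rule rapid_integrable)
  have "(\<integral>x. q n x \<partial>lborel) = 0" for n
  proof -
    have "integrable lborel (\<lambda>x. h (x + \<epsilon> n *\<^sub>R e))" using hi by (simp add: integrable_lborel_translate)
    then show ?thesis
      using hi unfolding q_def by (simp add: integral_lborel_translate)
  qed
  moreover have "(\<lambda>n. \<integral>x. q n x \<partial>lborel) \<longlonglongrightarrow> (\<integral>x. h' x \<partial>lborel)"
    using h'm lim q_bd by (intro integral_dominated_convergence[OF _ _ w]) auto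
  ultimately show ?thesis
    by (simp add: LIMSEQ_const_iff)
qed

section \<open>Schwartz functions\<close>

lemma schwartz_partial_deriv: "schwartz f \<Longrightarrow> schwartz (partial_deriv i f)"
  unfolding schwartz_def
proof (intro allI)
  fix js
  assume "\<forall>js. (\<forall>x. foldr partial_deriv js f differentiable at x) \<and>
     (\<forall>N::nat. bounded (range (\<lambda>x. (1 + norm x) ^ N *\<^sub>R foldr partial_deriv js f x)))"
  \<comment> \<open>\<open>foldr\<close> applies the last list entry first, so appending i
    differentiates f in direction i before all others.\<close>
  from this[rule_format, of "js @ [i]"]
  show "(\<forall>x. foldr partial_deriv js (partial_deriv i f) differentiable at x) \<and>
     (\<forall>N::nat. bounded (range (\<lambda>x. (1 + norm x) ^ N *\<^sub>R foldr partial_deriv js (partial_deriv i f) x)))"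
    by simp
qed

lemma schwartz_rapid:
  fixes f :: "real ^ 'n \<Rightarrow> 'b::{real_normed_vector, second_countable_topology}"
  assumes "schwartz f" shows "rapid f"
proof -
  have d: "f differentiable at x" and b: "bounded (range (\<lambda>x. (1 + norm x) ^ N *\<^sub>R f x))" for x and N :: nat
    using assms[unfolded schwartz_def, rule_format, of "[]"] by auto
  have "continuous_on UNIV f"
    using d by (auto intro!: continuous_at_imp_continuous_on differentiable_imp_continuous_within)
  then have "f \<in> borel_measurable borel" by (rule borel_measurable_continuous_onI)
  moreover have "\<exists>C. \<forall>x. (1 + norm x) ^ N * norm (f x) \<le> C" for N
    using b[of N] by (auto simp: bounded_iff)
  ultimately show ?thesis by (simp add: rapid_def)
qed

lemma schwartz_has_pd:
  assumes "schwartz f" shows "has_pd (axis i 1) f (partial_deriv i f)"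
  unfolding has_pd_def
proof
  fix x
  have "f differentiable at x"
    using assms[unfolded schwartz_def, rule_format, of "[]"] by auto
  then have "(\<lambda>r. f (x + r *\<^sub>R axis i 1)) differentiable at 0"
    by (intro differentiable_compose[of f "\<lambda>r. x + r *\<^sub>R axis i 1"]) (auto intro!: derivative_intros)
  then show "((\<lambda>r. f (x + r *\<^sub>R axis i 1)) has_vector_derivative partial_deriv i f x) (at 0)"
    unfolding partial_deriv_def by (rule vector_derivative_works[THEN iffD1])
qed

section \<open>Clifford algebra estimates\<close>

text \<open>In finite dimension bilinearity gives boundedness. The resulting constant stays in the
  estimates, because the coefficient norm need not be submultiplicative.\<close>

lemma bounded_bilinear_clifford_mult: "bounded_bilinear ((\<star>) :: 'n::{finite,linorder} clifford \<Rightarrow> _)"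
  unfolding bilinear_conv_bounded_bilinear[symmetric] bilinear_def clifford_mult_def
  by (auto intro!: linearI simp: algebra_simps scaleR_left_distrib scaleR_sum_right sum.distrib)

lemma norm_clifford_e_mult [simp]: "norm (clifford_e j \<star> clifford_e k) = 1"
proof -
  have "\<bar>clifford_sign A B\<bar> = 1" for A B :: "'a set" by (simp add: clifford_sign_def power_abs)
  then show ?thesis by (simp add: clifford_e_def clifford_mult_axis)
qed

text \<open>The Gram determinant of x and y, equal to t^2 in the kernel. It is polynomial in x, so
  together with \<open>bessel_sq\<close> it removes the square root that would obstruct
  differentiation where t = 0.\<close>

definition gram :: "'a::real_inner \<Rightarrow> 'a \<Rightarrow> real" where
  "gram x y = (norm x)\<^sup>2 * (norm y)\<^sup>2 - (x \<bullet> y)\<^sup>2"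

lemma gram_nonneg: "gram x y \<ge> 0"
  using Cauchy_Schwarz_ineq[of x y] by (simp add: gram_def power2_norm_eq_inner)

text \<open>Lagrange's identity: summed over all ordered pairs (j, k), the squared minors give twice
  the Gram determinant.\<close>

lemma minor_le_gram: "(x $ j * y $ k - x $ k * y $ j)\<^sup>2 \<le> 2 * gram x (y :: real ^ 'n)"
proof -
  have "(x $ j * y $ k - x $ k * y $ j)\<^sup>2 \<le> (\<Sum>k\<in>UNIV. (x $ j * y $ k - x $ k * y $ j)\<^sup>2)"
    by (rule member_le_sum) auto
  also have "\<dots> \<le> (\<Sum>j\<in>UNIV. \<Sum>k\<in>UNIV. (x $ j * y $ k - x $ k * y $ j)\<^sup>2)"
    by (rule member_le_sum[of j UNIV "\<lambda>j. \<Sum>k\<in>UNIV. (x $ j * y $ k - x $ k * y $ j)\<^sup>2"]) (auto intro: sum_nonneg)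
  also have "\<dots> = (\<Sum>j\<in>UNIV. \<Sum>k\<in>UNIV. (x $ j)\<^sup>2 * (y $ k)\<^sup>2 + (y $ j)\<^sup>2 * (x $ k)\<^sup>2
      - 2 * ((x $ j * y $ j) * (x $ k * y $ k)))"
    by (intro sum.cong refl) (simp add: power2_eq_square algebra_simps)
  also have "\<dots> = 2 * gram x y"
  proof -
    have "(\<Sum>j\<in>UNIV. \<Sum>k\<in>UNIV. (a $ j)\<^sup>2 * (b $ k)\<^sup>2) = (norm a)\<^sup>2 * (norm b)\<^sup>2" for a b :: "real ^ 'n"
      unfolding power2_norm_eq_inner by (simp add: inner_vec_def sum_product power2_eq_square)
    moreover have "(\<Sum>j\<in>UNIV. \<Sum>k\<in>UNIV. (x $ j * y $ j) * (x $ k * y $ k)) = (x \<bullet> y)\<^sup>2"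
      by (simp add: inner_vec_def sum_product power2_eq_square)
    ultimately show ?thesis
      by (simp add: gram_def sum.distrib sum_subtractf sum_distrib_left[symmetric])
  qed
  finally show ?thesis .
qed

lemma norm_clifford_wedge_le:
  fixes x y :: "real ^ 'n::{finite,linorder}"
  shows "norm (clifford_wedge x y) \<le> real (card {(j::'n, k). j < k}) * sqrt 2 * sqrt (gram x y)"
proof -
  have "norm (clifford_wedge x y)
      \<le> (\<Sum>p\<in>{(j::'n, k). j < k}. norm (case p of (j, k) \<Rightarrow>
          (x $ j * y $ k - x $ k * y $ j) *\<^sub>R (clifford_e j \<star> clifford_e k)))"
    unfolding clifford_wedge_def by (rule norm_sum)
  also have "\<dots> \<le> (\<Sum>p\<in>{(j::'n, k). j < k}. sqrt (2 * gram x y))"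
  proof (rule sum_mono, clarify)
    fix j k :: 'n
    have "\<bar>x $ j * y $ k - x $ k * y $ j\<bar> \<le> sqrt (2 * gram x y)"
      using minor_le_gram[of x j y k] by (intro real_le_rsqrt) (simp add: power2_abs)
    then show "norm ((x $ j * y $ k - x $ k * y $ j) *\<^sub>R (clifford_e j \<star> clifford_e k)) \<le> sqrt (2 * gram x y)"
      by simp
  qed
  finally show ?thesis by (simp add: real_sqrt_mult mult_ac)
qed

lemma clifford_wedge_add_axis:
  "clifford_wedge (x + r *\<^sub>R z) y = clifford_wedge x y + r *\<^sub>R clifford_wedge z y"
  unfolding clifford_wedge_def
  by (simp add: scaleR_sum_right case_prod_unfold algebra_simps flip: sum.distrib scaleR_left_distrib)

lemma linear_clifford_wedge: "linear (\<lambda>x. clifford_wedge x y)"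
  using clifford_wedge_add_axis[of _ 1 _ y] clifford_wedge_add_axis[of 0 _ _ y]
  by (intro linearI) (auto simp: clifford_wedge_def)

text \<open>Euler's identity for the linear map \<open>\<lambda>x. clifford_wedge x y\<close>. At z
  = x it gives homogeneity degree 1; at z = y it gives zero, so this map is constant in direction
  y.\<close>

lemma clifford_wedge_sum_axis:
  "(\<Sum>i\<in>UNIV. z $ i *\<^sub>R clifford_wedge (axis i 1) y) = clifford_wedge z y"
proof -
  have "(\<Sum>i\<in>UNIV. z $ i *\<^sub>R clifford_wedge (axis i 1) y) = clifford_wedge (\<Sum>i\<in>UNIV. z $ i *\<^sub>R axis i 1) y"
    by (simp add: linear_sum[OF linear_clifford_wedge] linear_scale[OF linear_clifford_wedge])
  also have "(\<Sum>i\<in>UNIV. z $ i *\<^sub>R axis i 1) = z"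
    using basis_expansion[of z] by (simp add: scalar_mult_eq_scaleR)
  finally show ?thesis .
qed

lemma clifford_wedge_self: "clifford_wedge y y = 0"
  by (simp add: clifford_wedge_def mult.commute)

lemma continuous_on_clifford_wedge [continuous_intros]:
  "continuous_on S f \<Longrightarrow> continuous_on S g \<Longrightarrow> continuous_on S (\<lambda>x. clifford_wedge (f x) (g x))"
  unfolding clifford_wedge_def case_prod_unfold by (intro continuous_intros) auto

section \<open>The kernel is a Laplace eigenfunction\<close>

text \<open>Packages what Green's identity against a Schwartz function consumes: the eigenvalue
  equation together with polynomial growth of the function and of its pure derivatives up to order
  two.\<close>

definition laplace_eigen ::
    "real ^ 'n \<Rightarrow> (real ^ 'n \<Rightarrow> 'b::{real_normed_vector, second_countable_topology}) \<Rightarrow> bool" where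
  "laplace_eigen y K \<longleftrightarrow> tempered K \<and> (\<exists>K' K''.
     (\<forall>i. has_pd (axis i 1) K (K' i) \<and> has_pd (axis i 1) (K' i) (K'' i) \<and> tempered (K' i) \<and> tempered (K'' i)) \<and>
     (\<forall>x. (\<Sum>i\<in>UNIV. K'' i x) = - ((norm y)\<^sup>2 *\<^sub>R K x)))"

lemma laplace_eigenI:
  assumes "tempered K" "\<And>i. has_pd (axis i 1) K (K' i)" "\<And>i. has_pd (axis i 1) (K' i) (K'' i)"
    "\<And>i. tempered (K' i)" "\<And>i. tempered (K'' i)"
    "\<And>x. (\<Sum>i\<in>UNIV. K'' i x) = - ((norm y)\<^sup>2 *\<^sub>R K x)"
  shows "laplace_eigen y K"
  unfolding laplace_eigen_def by (intro conjI exI[of _ K'] exI[of _ K''] allI assms)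

lemma has_pd_add: "has_pd e f f' \<Longrightarrow> has_pd e g g' \<Longrightarrow> has_pd e (\<lambda>x. f x + g x) (\<lambda>x. f' x + g' x)"
  by (auto simp: has_pd_def intro!: derivative_intros)

lemma has_pd_scaleR_const: "has_pd e f f' \<Longrightarrow> has_pd e (\<lambda>x. c *\<^sub>R f x) (\<lambda>x. c *\<^sub>R f' x)"
  by (auto simp: has_pd_def intro!: bounded_linear.has_vector_derivative[OF bounded_linear_scaleR_right])

lemma laplace_eigen_add:
  assumes "laplace_eigen y K" "laplace_eigen y L"
  shows "laplace_eigen y (\<lambda>x. K x + L x)"
proof -
  from assms obtain K' K'' L' L'' where
    "\<forall>i. has_pd (axis i 1) K (K' i) \<and> has_pd (axis i 1) (K' i) (K'' i) \<and> tempered (K' i) \<and> tempered (K'' i)"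
    "\<forall>x. (\<Sum>i\<in>UNIV. K'' i x) = - ((norm y)\<^sup>2 *\<^sub>R K x)"
    "\<forall>i. has_pd (axis i 1) L (L' i) \<and> has_pd (axis i 1) (L' i) (L'' i) \<and> tempered (L' i) \<and> tempered (L'' i)"
    "\<forall>x. (\<Sum>i\<in>UNIV. L'' i x) = - ((norm y)\<^sup>2 *\<^sub>R L x)"
    unfolding laplace_eigen_def by metis
  then show ?thesis
    using assms unfolding laplace_eigen_def
    by (intro conjI exI[of _ "\<lambda>i x. K' i x + L' i x"] exI[of _ "\<lambda>i x. K'' i x + L'' i x"])
       (auto intro: tempered_add has_pd_add simp: sum.distrib scaleR_add_right)
qed

lemma laplace_eigen_scaleR:
  assumes "laplace_eigen y K"
  shows "laplace_eigen y (\<lambda>x. c *\<^sub>R K x)"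
proof -
  from assms obtain K' K'' where
    "\<forall>i. has_pd (axis i 1) K (K' i) \<and> has_pd (axis i 1) (K' i) (K'' i) \<and> tempered (K' i) \<and> tempered (K'' i)"
    "\<forall>x. (\<Sum>i\<in>UNIV. K'' i x) = - ((norm y)\<^sup>2 *\<^sub>R K x)"
    unfolding laplace_eigen_def by metis
  note h = this
  have "(\<Sum>i\<in>UNIV. c *\<^sub>R K'' i x) = - ((norm y)\<^sup>2 *\<^sub>R c *\<^sub>R K x)" for x
    unfolding scaleR_sum_right[symmetric] h(2)[rule_format] by simp
  moreover have "tempered (\<lambda>x. c *\<^sub>R K x)"
    using assms by (intro tempered_scaleR[OF tempered_const]) (simp add: laplace_eigen_def)
  moreover have "has_pd (axis i 1) (\<lambda>x. c *\<^sub>R K x) (\<lambda>x. c *\<^sub>R K' i x)"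
    "has_pd (axis i 1) (\<lambda>x. c *\<^sub>R K' i x) (\<lambda>x. c *\<^sub>R K'' i x)"
    "tempered (\<lambda>x. c *\<^sub>R K' i x)" "tempered (\<lambda>x. c *\<^sub>R K'' i x)" for i
    using h(1) by (simp_all add: has_pd_scaleR_const tempered_scaleR[OF tempered_const])
  ultimately show ?thesis
    by (intro laplace_eigenI[where K' = "\<lambda>i x. c *\<^sub>R K' i x" and K'' = "\<lambda>i x. c *\<^sub>R K'' i x"])
qed

lemma abs_inner_le_one_plus_norm_mult: "\<bar>x \<bullet> y\<bar> \<le> (1 + norm x) * (1 + norm y)"
proof -
  have "\<bar>x \<bullet> y\<bar> \<le> norm x * norm y" by (rule Cauchy_Schwarz_ineq2)
  also have "\<dots> \<le> (1 + norm x) * (1 + norm y)" by (intro mult_mono) auto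
  finally show ?thesis .
qed

lemma one_le_one_plus_norm_mult: "1 \<le> (1 + norm x) * (1 + norm y)"
  using mult_mono[of 1 "1 + norm x" 1 "1 + norm y"] by simp

lemma tempered_bessel_appell:
  fixes y :: "'a::euclidean_space"
  assumes "\<And>l. 2 * int l \<le> m \<Longrightarrow> b - real l \<ge> - 1/2"
  shows "tempered (\<lambda>x. bessel_appell M m b (x \<bullet> y) (gram x y))"
proof -
  define C where "C = (\<Sum>l\<le>M. \<bar>\<bar>bessel_sq (b - real l) 0\<bar>\<bar>)"
  have "norm (bessel_appell M m b (x \<bullet> y) (gram x y)) \<le> (C * (1 + norm y) ^ nat m) * (1 + norm x) ^ nat m" for x
  proof -
    have "1 * \<bar>bessel_appell M m b (x \<bullet> y) (gram x y)\<bar> \<le> C * ((1 + norm x) * (1 + norm y)) ^ nat m"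
      unfolding C_def using assms
      by (intro bessel_appell_weighted_bound one_le_one_plus_norm_mult abs_inner_le_one_plus_norm_mult)
         (auto intro!: bessel_sq_bound gram_nonneg)
    then show ?thesis by (simp add: power_mult_distrib mult_ac)
  qed
  moreover have "(\<lambda>x. bessel_appell M m b (x \<bullet> y) (gram x y)) \<in> borel_measurable borel"
    unfolding gram_def by (intro borel_measurable_continuous_onI continuous_intros)
  ultimately show ?thesis unfolding tempered_def by blast
qed

text \<open>W is affine, so the Laplacian of the product is that of the Bessel factor times W plus
  twice the inner product of the gradients. Since W is constant along y and homogeneous of degree
  \<kappa>, the latter only adds 2\<kappa> to the coefficient d - 1 of the index b + 1, and
  \<open>b\<close> is the condition for \<open>bessel_appell_pde\<close> to apply.\<close>

lemma laplace_eigen_bessel_appell: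
  fixes y :: "real ^ 'n" and W :: "real ^ 'n \<Rightarrow> 'b::{real_normed_vector, second_countable_topology}"
  assumes W: "\<And>x r i. W (x + r *\<^sub>R axis i 1) = W x + r *\<^sub>R w i" and tW: "tempered W"
    and yw: "(\<Sum>i\<in>UNIV. y $ i *\<^sub>R w i) = 0"
    and xw: "\<And>x. (\<Sum>i\<in>UNIV. x $ i *\<^sub>R w i) = \<kappa> *\<^sub>R W x"
    and b: "2 * (b + 1) = real CARD('n) - 1 + 2 * \<kappa>"
    and m: "m < 2 * int M + 2" and bl: "\<And>l. 2 * int l \<le> m \<Longrightarrow> b - real l \<ge> - 1/2"
  shows "laplace_eigen y (\<lambda>x. bessel_appell M m b (x \<bullet> y) (gram x y) *\<^sub>R W x)"
proof -
  define Y where "Y = (norm y)\<^sup>2"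
  define T where "T m b x = bessel_appell M m b (x \<bullet> y) (gram x y)" for m b x
  \<comment> \<open>\<open>u i\<close> is the i-th partial derivative of the Gram determinant in x;
    \<open>D1 i\<close> and \<open>D2 i\<close> are the first and second ones of
    \<open>T m b\<close>.\<close>
  define u where "u i x = 2 * (x $ i * Y - (x \<bullet> y) * y $ i)" for i :: 'n and x :: "real ^ 'n"
  define D1 where "D1 i x = T (m - 1) b x * y $ i - T m (b + 1) x / 2 * u i x" for i x
  define D2 where "D2 i x = (T (m - 2) b x * y $ i - T (m - 1) (b + 1) x / 2 * u i x) * y $ i
     - ((T (m - 1) (b + 1) x * y $ i - T m (b + 2) x / 2 * u i x) / 2 * u i x + T m (b + 1) x / 2 * (2 * (Y - (y $ i)\<^sup>2)))" for i x
  have ds: "((\<lambda>r. (x + r *\<^sub>R axis i 1) \<bullet> y) has_real_derivative y $ i) (at 0)" for x i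
    by (auto intro!: derivative_eq_intros simp: inner_add_left inner_axis')
  have dg: "((\<lambda>r. gram (x + r *\<^sub>R axis i 1) y) has_real_derivative u i x) (at 0)" for x i
    unfolding gram_def power2_norm_eq_inner u_def Y_def
    by (auto intro!: derivative_eq_intros
      simp: inner_add_left inner_add_right inner_axis inner_axis' power2_eq_square algebra_simps)
  have du: "((\<lambda>r. u i (x + r *\<^sub>R axis i 1)) has_real_derivative 2 * (Y - (y $ i)\<^sup>2)) (at 0)" for x i
    unfolding u_def
    by (auto intro!: derivative_eq_intros simp: inner_add_left inner_axis' power2_eq_square algebra_simps)
  have dT: "((\<lambda>r. T m b (x + r *\<^sub>R axis i 1)) has_real_derivative
      T (m - 1) b x * y $ i - T m (b + 1) x / 2 * u i x) (at 0)" for m b x i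
    unfolding T_def by (rule DERIV_bessel_appell[OF ds dg]) simp
  have dD1: "((\<lambda>r. D1 i (x + r *\<^sub>R axis i 1)) has_real_derivative D2 i x) (at 0)" for x i
  proof -
    have [simp]: "m - 1 - 1 = m - 2" "b + 1 + 1 = b + 2" by auto
    show ?thesis
      unfolding D1_def D2_def
      using dT[where m="m - 1" and b=b and x=x and i=i] dT[where m=m and b="b+1" and x=x and i=i] du[of i x]
      by (auto intro!: derivative_eq_intros simp: field_simps)
  qed
  have dW: "((\<lambda>r. W (x + r *\<^sub>R axis i 1)) has_vector_derivative w i) (at 0)" for x i
    unfolding W by (auto intro!: derivative_eq_intros)
  define K' where "K' i x = D1 i x *\<^sub>R W x + T m b x *\<^sub>R w i" for i x
  define K'' where "K'' i x = D2 i x *\<^sub>R W x + (2 * D1 i x) *\<^sub>R w i" for i x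
  have 1: "has_pd (axis i 1) (\<lambda>x. T m b x *\<^sub>R W x) (K' i)" for i
    unfolding has_pd_def K'_def
  proof
    fix x
    show "((\<lambda>r. T m b (x + r *\<^sub>R axis i 1) *\<^sub>R W (x + r *\<^sub>R axis i 1)) has_vector_derivative
       D1 i x *\<^sub>R W x + T m b x *\<^sub>R w i) (at 0)"
      using has_vector_derivative_scaleR[OF dT[where m=m and b=b and x=x and i=i] dW[of x i]] by (simp add: D1_def add.commute)
  qed
  have 2: "has_pd (axis i 1) (K' i) (K'' i)" for i
    unfolding has_pd_def K'_def K''_def
  proof
    fix x
    show "((\<lambda>r. D1 i (x + r *\<^sub>R axis i 1) *\<^sub>R W (x + r *\<^sub>R axis i 1) + T m b (x + r *\<^sub>R axis i 1) *\<^sub>R w i)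
       has_vector_derivative D2 i x *\<^sub>R W x + (2 * D1 i x) *\<^sub>R w i) (at 0)"
    proof (rule has_vector_derivative_eq_rhs)
      show "((\<lambda>r. D1 i (x + r *\<^sub>R axis i 1) *\<^sub>R W (x + r *\<^sub>R axis i 1) + T m b (x + r *\<^sub>R axis i 1) *\<^sub>R w i)
         has_vector_derivative (D1 i x *\<^sub>R w i + D2 i x *\<^sub>R W x) + (T m b x *\<^sub>R 0 + D1 i x *\<^sub>R w i)) (at 0)"
        using has_vector_derivative_scaleR[OF dD1[of i x] dW[of x i]]
          has_vector_derivative_scaleR[OF dT[where m=m and b=b and x=x and i=i] has_vector_derivative_const[of "w i"]]
        unfolding D1_def[of i x, symmetric] by (intro has_vector_derivative_add) simp_all
      show "(D1 i x *\<^sub>R w i + D2 i x *\<^sub>R W x) + (T m b x *\<^sub>R 0 + D1 i x *\<^sub>R w i)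
          = D2 i x *\<^sub>R W x + (2 * D1 i x) *\<^sub>R w i"
        by (simp only: mult_2 scaleR_left_distrib) (simp only: scaleR_zero_right add_0_left add_ac)
    qed
  qed
  \<comment> \<open>Differentiation only lowers m and raises b, and both keep the occurring Bessel
    indices at or above -1/2.\<close>
  have tT: "tempered (T m' b')" if "m' \<le> m" "b' \<ge> b" for m' b'
    unfolding T_def
  proof (rule tempered_bessel_appell)
    fix l assume "2 * int l \<le> m'"
    then show "b' - real l \<ge> - 1/2" using bl[of l] that by simp
  qed
  have tu: "tempered (u i)" for i
    unfolding u_def
    by (intro tempered_intros tempered_linear bounded_linear_inner_left bounded_linear_vec_nth)
  have tK: "tempered (\<lambda>x. T m b x *\<^sub>R W x)" "tempered (K' i)" "tempered (K'' i)" for i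
    unfolding K'_def K''_def D1_def D2_def divide_inverse
    by (intro tempered_intros tW tT tu; simp)+
  have 3: "(\<Sum>i\<in>UNIV. K'' i x) = - ((norm y)\<^sup>2 *\<^sub>R (T m b x *\<^sub>R W x))" for x
  proof -
    have yy: "(\<Sum>i\<in>UNIV. y $ i * y $ i) = Y" and xx: "(\<Sum>i\<in>UNIV. x $ i * x $ i) = (norm x)\<^sup>2"
      and xy: "(\<Sum>i\<in>UNIV. x $ i * y $ i) = x \<bullet> y"
      by (simp_all add: Y_def power2_norm_eq_inner inner_vec_def)
    \<comment> \<open>The gradient of the Gram determinant is orthogonal to y, which kills the mixed
      second derivative in s and u.\<close>
    have uy: "(\<Sum>i\<in>UNIV. u i x * y $ i) = 0"
    proof -
      have "(\<Sum>i\<in>UNIV. u i x * y $ i) = 2 * Y * (\<Sum>i\<in>UNIV. x $ i * y $ i) - 2 * (x \<bullet> y) * (\<Sum>i\<in>UNIV. y $ i * y $ i)"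
        unfolding sum_distrib_left sum_subtractf[symmetric] u_def by (intro sum.cong refl) (simp add: algebra_simps)
      then show ?thesis unfolding xy yy by simp
    qed
    have uu: "(\<Sum>i\<in>UNIV. u i x * u i x) = 4 * Y * gram x y"
    proof -
      have "(\<Sum>i\<in>UNIV. u i x * u i x) = 4 * Y\<^sup>2 * (\<Sum>i\<in>UNIV. x $ i * x $ i)
          - 8 * Y * (x \<bullet> y) * (\<Sum>i\<in>UNIV. x $ i * y $ i) + 4 * (x \<bullet> y)\<^sup>2 * (\<Sum>i\<in>UNIV. y $ i * y $ i)"
        unfolding sum_distrib_left sum_subtractf[symmetric] sum.distrib[symmetric] u_def
        by (intro sum.cong refl) (simp add: algebra_simps power2_eq_square)
      then show ?thesis by (simp add: xx xy yy gram_def Y_def power2_eq_square algebra_simps)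
    qed
    have sD2: "(\<Sum>i\<in>UNIV. D2 i x) = Y * (T (m - 2) b x + gram x y * T m (b + 2) x - (real CARD('n) - 1) * T m (b + 1) x)"
    proof -
      have "(\<Sum>i\<in>UNIV. D2 i x) = T (m - 2) b x * (\<Sum>i\<in>UNIV. y $ i * y $ i)
          - T (m - 1) (b + 1) x * (\<Sum>i\<in>UNIV. u i x * y $ i) + T m (b + 2) x / 4 * (\<Sum>i\<in>UNIV. u i x * u i x)
          - T m (b + 1) x * (\<Sum>i\<in>(UNIV :: 'n set). Y) + T m (b + 1) x * (\<Sum>i\<in>UNIV. y $ i * y $ i)"
        unfolding sum_distrib_left sum_subtractf[symmetric] sum.distrib[symmetric] D2_def
        by (intro sum.cong refl) (simp add: field_simps power2_eq_square)
      then show ?thesis unfolding yy uy uu by (simp add: algebra_simps)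
    qed
    \<comment> \<open>The cross term: only the x-part of the gradient of u survives, as W does not
      vary along y.\<close>
    have sD1: "(\<Sum>i\<in>UNIV. D1 i x *\<^sub>R w i) = - (T m (b + 1) x * Y * \<kappa>) *\<^sub>R W x"
    proof -
      have "(\<Sum>i\<in>UNIV. D1 i x *\<^sub>R w i) = (T (m - 1) b x + T m (b + 1) x * (x \<bullet> y)) *\<^sub>R (\<Sum>i\<in>UNIV. y $ i *\<^sub>R w i)
          - (T m (b + 1) x * Y) *\<^sub>R (\<Sum>i\<in>UNIV. x $ i *\<^sub>R w i)"
        unfolding scaleR_sum_right sum_subtractf[symmetric] D1_def u_def
        by (intro sum.cong refl) (simp add: algebra_simps flip: scaleR_left_distrib scaleR_left_diff_distrib)
      then show ?thesis by (simp add: yw xw)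
    qed
    have "(\<Sum>i\<in>UNIV. K'' i x) = (\<Sum>i\<in>UNIV. D2 i x) *\<^sub>R W x + 2 *\<^sub>R (\<Sum>i\<in>UNIV. D1 i x *\<^sub>R w i)"
      by (simp add: K''_def sum.distrib scaleR_left.sum scaleR_sum_right)
    also have "\<dots> = (Y * (T (m - 2) b x + gram x y * T m (b + 2) x - 2 * (b + 1) * T m (b + 1) x)) *\<^sub>R W x"
      unfolding sD2 sD1 b by (simp add: algebra_simps flip: scaleR_left_distrib scaleR_left_diff_distrib)
    also have "\<dots> = - (Y *\<^sub>R (T m b x *\<^sub>R W x))"
      unfolding T_def bessel_appell_pde[OF m] by simp
    finally show ?thesis by (simp add: Y_def)
  qed
  show ?thesis
    unfolding T_def[symmetric] by (rule laplace_eigenI[OF tK(1) 1 2 tK(2,3) 3])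
qed

section \<open>Identifying the sums of the kernel with the Appell family\<close>

lemma fact_mult_bessel_appell:
  assumes "m \<le> 2 * int M + 1"
  shows "fact N * bessel_appell M m b s u = (\<Sum>l | 2 * int l \<le> m.
     s ^ nat (m - 2 * int l) * (1 / (2 ^ l * fact l)) * (fact N / fact (nat (m - 2 * int l)))
       * bessel_sq (b - real l) u)"
proof -
  have "fact N * bessel_appell M m b s u
      = (\<Sum>l\<le>M. fact N * (dpow (m - 2 * int l) s / (2 ^ l * fact l) * bessel_sq (b - real l) u))"
    unfolding bessel_appell_def by (rule sum_distrib_left)
  also have "\<dots> = (\<Sum>l | 2 * int l \<le> m. s ^ nat (m - 2 * int l) * (1 / (2 ^ l * fact l))
       * (fact N / fact (nat (m - 2 * int l))) * bessel_sq (b - real l) u)"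
    using assms by (intro sum.mono_neutral_cong_right) (auto simp: dpow_def mult_ac)
  finally show ?thesis .
qed

lemma Gamma_diff_fact: "2 * l \<le> n \<Longrightarrow> Gamma (real n - 2 * real l + 1) = fact (n - 2 * l)"
  using Gamma_fact[of "n - 2 * l", where 'a = real] by (simp add: of_nat_diff add.commute)

lemma half_index: "{l. int l \<le> \<lfloor>real lam / 2\<rfloor>} = {l. 2 * int l \<le> int lam}"
  by (auto simp: le_floor_iff)

lemma A_star_eq:
  assumes "lam \<ge> 1" "t \<ge> 0"
  shows "A_star lam s t = fact lam * bessel_appell lam (int lam - 1) (real lam - 1/2) s (t\<^sup>2)"
proof -
  \<comment> \<open>The bound says 2l <= lam - 1/2, and integrality lowers the right side to lam -
    1.\<close>
  have set: "{l. int l \<le> \<lfloor>(real lam + 1) / 2 - 3 / 4\<rfloor>} = {l. 2 * int l \<le> int lam - 1}"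
    by (auto simp: le_floor_iff field_simps)
  have b: "(2 * real lam - 2 * real l - 1) / 2 = real lam - 1 / 2 - real l" for l by (simp add: field_simps)
  show ?thesis
    unfolding A_star_def set
  proof (subst fact_mult_bessel_appell, simp, rule sum.cong[OF refl])
    fix l assume "l \<in> {l. 2 * int l \<le> int lam - 1}"
    then have l: "2 * l \<le> lam - 1" "nat (int lam - 1 - 2 * int l) = lam - 1 - 2 * l"
      using assms by auto
    have "Gamma (real lam - 2 * real l) = fact (lam - 1 - 2 * l)"
      using Gamma_diff_fact[OF l(1)] assms by (simp add: of_nat_diff)
    then show "s ^ (lam - 1 - 2 * l) * (1 / (2 ^ l * fact l)) * (Gamma (real lam + 1) / Gamma (real lam - 2 * real l))
        * bessel_J_tilde ((2 * real lam - 2 * real l - 1) / 2) t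
      = s ^ nat (int lam - 1 - 2 * int l) * (1 / (2 ^ l * fact l))
        * (fact lam / fact (nat (int lam - 1 - 2 * int l))) * bessel_sq (real lam - 1 / 2 - real l) (t\<^sup>2)"
      using Gamma_fact[of lam, where 'a = real] assms(2)
      unfolding l(2) b by (simp add: bessel_J_tilde_conv add.commute)
  qed
qed

lemma
  assumes "t \<ge> 0"
  shows B_star_eq: "B_star lam s t = - fact lam * bessel_appell lam (int lam) (real lam - 1/2) s (t\<^sup>2)"
    and C_star_eq: "C_star lam s t = - fact lam * bessel_appell lam (int lam) (real lam + 1/2) s (t\<^sup>2)"
proof -
  have b: "(2 * real lam - 2 * real l - 1) / 2 = real lam - 1 / 2 - real l"
    "(2 * real lam - 2 * real l + 1) / 2 = real lam + 1 / 2 - real l" for l by (simp_all add: field_simps)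
  \<comment> \<open>The two sums differ only in the Bessel index, so one computation with b free
    serves both.\<close>
  have *: "(\<Sum>l | 2 * int l \<le> int lam. s ^ (lam - 2 * l) * (1 / (2 ^ l * fact l))
        * (Gamma (real lam + 1) / Gamma (real lam - 2 * real l + 1)) * bessel_J_tilde (b - real l) t)
      = fact lam * bessel_appell lam (int lam) b s (t\<^sup>2)" for b
  proof (subst fact_mult_bessel_appell, simp, rule sum.cong[OF refl])
    fix l assume "l \<in> {l. 2 * int l \<le> int lam}"
    then have l: "2 * l \<le> lam" "nat (int lam - 2 * int l) = lam - 2 * l" by auto
    then show "s ^ (lam - 2 * l) * (1 / (2 ^ l * fact l)) * (Gamma (real lam + 1) / Gamma (real lam - 2 * real l + 1))
        * bessel_J_tilde (b - real l) t
      = s ^ nat (int lam - 2 * int l) * (1 / (2 ^ l * fact l))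
        * (fact lam / fact (nat (int lam - 2 * int l))) * bessel_sq (b - real l) (t\<^sup>2)"
      using Gamma_fact[of lam, where 'a = real] assms Gamma_diff_fact[OF l(1)]
      unfolding l(2) by (simp add: bessel_J_tilde_conv add.commute)
  qed
  show "B_star lam s t = - fact lam * bessel_appell lam (int lam) (real lam - 1/2) s (t\<^sup>2)"
    "C_star lam s t = - fact lam * bessel_appell lam (int lam) (real lam + 1/2) s (t\<^sup>2)"
    unfolding B_star_def C_star_def half_index b * by simp_all
qed

text \<open>The signs are written as scalar factors so that closure of \<open>laplace_eigen\<close>
  under sums and multiples applies literally.\<close>

lemma clifford_kernel_eq:
  fixes x y :: "real ^ 'n::{finite,linorder}"
  assumes lam: "CARD('n) = 2 * lam + 2" "lam \<ge> 1"
  shows "clifford_kernel x y = ((-1) ^ (lam + 1) * sqrt (pi / 2) * fact lam) *\<^sub>R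
     (bessel_appell lam (int lam - 1) (real lam - 1/2) (x \<bullet> y) (gram x y) *\<^sub>R clifford_one
      + (-1) *\<^sub>R bessel_appell lam (int lam) (real lam - 1/2) (x \<bullet> y) (gram x y) *\<^sub>R clifford_one
      + (-1) *\<^sub>R bessel_appell lam (int lam) (real lam + 1/2) (x \<bullet> y) (gram x y) *\<^sub>R clifford_wedge x y)"
proof -
  have "(CARD('n) - 2) div 2 = lam" using lam by simp
  then show ?thesis
    unfolding clifford_kernel_def Let_def gram_def[symmetric]
    using gram_nonneg[of x y] lam
    by (simp add: A_star_eq B_star_eq C_star_eq algebra_simps)
qed

text \<open>With d = 2 lam + 2, the index lam - 1/2 satisfies the dimension condition for constant W
  (\<kappa> = 0) and lam + 1/2 satisfies it for the wedge (\<kappa> = 1).\<close>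

lemma laplace_eigen_clifford_kernel:
  fixes y :: "real ^ 'n::{finite,linorder}"
  assumes lam: "CARD('n) = 2 * lam + 2" "lam \<ge> 1"
  shows "laplace_eigen y (\<lambda>x. clifford_kernel x y)"
proof -
  have one: "laplace_eigen y (\<lambda>x. bessel_appell lam m (real lam - 1/2) (x \<bullet> y) (gram x y) *\<^sub>R (clifford_one :: 'n clifford))"
    if "m \<le> int lam" for m
    by (rule laplace_eigen_bessel_appell[where w = "\<lambda>i. 0" and \<kappa> = 0]) (use that lam in auto)
  have wedge: "laplace_eigen y (\<lambda>x. bessel_appell lam (int lam) (real lam + 1/2) (x \<bullet> y) (gram x y) *\<^sub>R clifford_wedge x y)"
  proof (rule laplace_eigen_bessel_appell[where w = "\<lambda>i. clifford_wedge (axis i 1) y" and \<kappa> = 1])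
    show "tempered (\<lambda>x. clifford_wedge x y)"
      using linear_clifford_wedge by (intro tempered_linear) (simp add: linear_conv_bounded_linear)
  qed (use lam in \<open>auto simp: clifford_wedge_add_axis clifford_wedge_sum_axis clifford_wedge_self\<close>)
  show ?thesis
    unfolding clifford_kernel_eq[OF lam] by (intro laplace_eigen_scaleR laplace_eigen_add one wedge) simp_all
qed

section \<open>Continuity and growth of the kernel\<close>

lemma continuous_on_clifford_kernel:
  assumes lam: "CARD('n::{finite,linorder}) = 2 * lam + 2" "lam \<ge> 1"
  shows "continuous_on UNIV (\<lambda>p. clifford_kernel (fst p) (snd p :: (real, 'n) vec))"
  unfolding clifford_kernel_eq[OF lam] gram_def by (intro continuous_intros)

text \<open>All sums have degree at most lam in s, and |s| is at most P = (1 + |x|)(1 + |y|). The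
  wedge contributes a factor sqrt(gram), which the second Bessel bound absorbs without raising the
  power of P.\<close>

lemma clifford_kernel_bound:
  assumes lam: "CARD('n::{finite,linorder}) = 2 * lam + 2" "lam \<ge> 1"
  obtains C where "C > 0"
    "\<And>x y :: (real, 'n) vec. norm (clifford_kernel x y) \<le> C * ((1 + norm x) ^ lam * (1 + norm y) ^ lam)"
proof -
  define c where "c = \<bar>(-1) ^ (lam + 1) * sqrt (pi / 2) * fact lam\<bar>"
  define C1 where "C1 = (\<Sum>l\<le>lam. \<bar>\<bar>bessel_sq (real lam - 1/2 - real l) 0\<bar>\<bar>)"
  define N where "N = real (card {(j::'n, k). j < k}) * sqrt 2"
  define C where "C = c * (C1 * norm (clifford_one :: 'n clifford) + C1 * norm (clifford_one :: 'n clifford) + N * C1)"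
  have "norm (clifford_kernel x y) \<le> C * ((1 + norm x) ^ lam * (1 + norm y) ^ lam)" for x y :: "(real, 'n) vec"
  proof -
    define P where "P = (1 + norm x) * (1 + norm y)"
    note P = one_le_one_plus_norm_mult[of x y, folded P_def] abs_inner_le_one_plus_norm_mult[of x y, folded P_def]
    have b: "\<bar>bessel_appell lam m (real lam - 1/2) (x \<bullet> y) (gram x y)\<bar> \<le> C1 * P ^ lam" if "m \<le> int lam" for m
    proof -
      have "1 * \<bar>bessel_appell lam m (real lam - 1/2) (x \<bullet> y) (gram x y)\<bar> \<le> C1 * P ^ lam"
        unfolding C1_def using that
        by (intro bessel_appell_weighted_bound P) (auto intro!: bessel_sq_bound gram_nonneg)
      then show ?thesis by simp
    qed
    have w: "sqrt (gram x y) * \<bar>bessel_appell lam (int lam) (real lam + 1/2) (x \<bullet> y) (gram x y)\<bar> \<le> C1 * P ^ lam"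
      unfolding C1_def
    proof (intro bessel_appell_weighted_bound P)
      fix l assume l: "2 * int l \<le> int lam"
      \<comment> \<open>Rewriting the index as a + 1 with a = lam - 1/2 - l bounds the weighted term
        by the same constants as in the scalar terms.\<close>
      have "(real lam - 1/2 - real l) + 1 = real lam + 1 / 2 - real l" by simp
      from bessel_sq_bound(2)[of "real lam - 1/2 - real l" "gram x y", unfolded this] l
      show "sqrt (gram x y) * \<bar>bessel_sq (real lam + 1 / 2 - real l) (gram x y)\<bar> \<le> \<bar>bessel_sq (real lam - 1 / 2 - real l) 0\<bar>"
        by (simp add: gram_nonneg)
    qed (simp_all add: gram_nonneg)
    have "norm (clifford_wedge x y) * \<bar>bessel_appell lam (int lam) (real lam + 1/2) (x \<bullet> y) (gram x y)\<bar>
        \<le> (N * sqrt (gram x y)) * \<bar>bessel_appell lam (int lam) (real lam + 1/2) (x \<bullet> y) (gram x y)\<bar>"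
      unfolding N_def by (intro mult_right_mono norm_clifford_wedge_le) simp
    also have "\<dots> \<le> N * (C1 * P ^ lam)"
      unfolding mult.assoc by (intro mult_left_mono w) (simp add: N_def)
    finally have w': "norm (clifford_wedge x y) * \<bar>bessel_appell lam (int lam) (real lam + 1/2) (x \<bullet> y) (gram x y)\<bar>
        \<le> N * (C1 * P ^ lam)" .
    have "norm (clifford_kernel x y) \<le> c *
        (\<bar>bessel_appell lam (int lam - 1) (real lam - 1/2) (x \<bullet> y) (gram x y)\<bar> * norm (clifford_one :: 'n clifford)
         + \<bar>bessel_appell lam (int lam) (real lam - 1/2) (x \<bullet> y) (gram x y)\<bar> * norm (clifford_one :: 'n clifford)
         + norm (clifford_wedge x y) * \<bar>bessel_appell lam (int lam) (real lam + 1/2) (x \<bullet> y) (gram x y)\<bar>)"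
      unfolding clifford_kernel_eq[OF lam] norm_scaleR c_def[symmetric] real_norm_def
      by (intro mult_left_mono norm_triangle_le add_mono) (auto simp: c_def)
    also have "\<dots> \<le> c * (C1 * P ^ lam * norm (clifford_one :: 'n clifford)
         + C1 * P ^ lam * norm (clifford_one :: 'n clifford) + N * (C1 * P ^ lam))"
      by (intro mult_left_mono add_mono mult_right_mono b w') (auto simp: c_def)
    also have "\<dots> = C * P ^ lam" by (simp add: C_def algebra_simps)
    finally show ?thesis by (simp add: P_def power_mult_distrib)
  qed
  \<comment> \<open>Enlarging C to |C| + 1 makes the constant positive without inspecting its
    parts.\<close>
  moreover have "C * ((1 + norm x) ^ lam * (1 + norm y) ^ lam)
      \<le> (\<bar>C\<bar> + 1) * ((1 + norm x) ^ lam * (1 + norm y) ^ lam)" for x y :: "(real, 'n) vec"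
    by (intro mult_right_mono) auto
  ultimately have "norm (clifford_kernel x y) \<le> (\<bar>C\<bar> + 1) * ((1 + norm x) ^ lam * (1 + norm y) ^ lam)"
    for x y :: "(real, 'n) vec"
    by (rule order_trans)
  then show ?thesis
    by (intro that[of "\<bar>C\<bar> + 1"]) auto
qed

section \<open>Decay of the transform\<close>

text \<open>Green's identity in one integration per direction: p(K, D\<phi>) - p(DK, \<phi>) has
  derivative p(K, DD\<phi>) - p(DDK, \<phi>), the cross terms cancelling, and the integral of this
  derivative is zero.\<close>

lemma laplace_eigen_integral:
  fixes K :: "real ^ 'n \<Rightarrow> 'b::{banach, second_countable_topology}"
    and \<phi> :: "real ^ 'n \<Rightarrow> 'c::{banach, second_countable_topology}"
    and p :: "'b \<Rightarrow> 'c \<Rightarrow> 'd::{banach, second_countable_topology}"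
  assumes p: "bounded_bilinear p" and K: "laplace_eigen y K" and \<phi>: "schwartz \<phi>"
  shows "(norm y)\<^sup>2 *\<^sub>R (\<integral>x. p (K x) (\<phi> x) \<partial>lborel)
    = - (\<Sum>i\<in>UNIV. \<integral>x. p (K x) (partial_deriv i (partial_deriv i \<phi>) x) \<partial>lborel)"
proof -
  interpret bounded_bilinear p by (rule p)
  obtain K' K'' where K': "\<And>i. has_pd (axis i 1) K (K' i)" "\<And>i. has_pd (axis i 1) (K' i) (K'' i)"
    and t: "tempered K" "\<And>i. tempered (K' i)" "\<And>i. tempered (K'' i)"
    and eig: "\<And>x. (\<Sum>i\<in>UNIV. K'' i x) = - ((norm y)\<^sup>2 *\<^sub>R K x)"
    using K unfolding laplace_eigen_def by blast
  have pp: "(\<integral>x. p (K x) (partial_deriv i (partial_deriv i \<phi>) x) \<partial>lborel) = (\<integral>x. p (K'' i x) (\<phi> x) \<partial>lborel)"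
    and int: "integrable lborel (\<lambda>x. p (K'' i x) (\<phi> x))" for i
  proof -
    let ?\<phi>1 = "partial_deriv i \<phi>" and ?\<phi>2 = "partial_deriv i (partial_deriv i \<phi>)"
    have s: "schwartz ?\<phi>1" "schwartz ?\<phi>2" using \<phi> by (simp_all add: schwartz_partial_deriv)
    have r: "rapid (\<lambda>x. p (K x) (?\<phi>1 x) - p (K' i x) (\<phi> x))"
      using \<phi> s t by (intro rapid_diff rapid_bilinear[OF p] schwartz_rapid)
    have r2: "rapid (\<lambda>x. p (K x) (?\<phi>2 x))" "rapid (\<lambda>x. p (K'' i x) (\<phi> x))"
      using \<phi> s t by (intro rapid_bilinear[OF p] schwartz_rapid; simp)+
    obtain C where C: "\<And>x. (1 + norm x) ^ (2 * DIM(real ^ 'n)) * norm (p (K x) (?\<phi>2 x) - p (K'' i x) (\<phi> x)) \<le> C"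
      using rapid_diff[OF r2] unfolding rapid_def by blast
    have "has_pd (axis i 1) (\<lambda>x. p (K x) (?\<phi>1 x) - p (K' i x) (\<phi> x)) (\<lambda>x. p (K x) (?\<phi>2 x) - p (K'' i x) (\<phi> x))"
      unfolding has_pd_def
    proof
      fix x
      have "((\<lambda>r. p (K (x + r *\<^sub>R axis i 1)) (?\<phi>1 (x + r *\<^sub>R axis i 1))
          - p (K' i (x + r *\<^sub>R axis i 1)) (\<phi> (x + r *\<^sub>R axis i 1))) has_vector_derivative
          (p (K (x + 0 *\<^sub>R axis i 1)) (?\<phi>2 x) + p (K' i x) (?\<phi>1 (x + 0 *\<^sub>R axis i 1)))
          - (p (K' i (x + 0 *\<^sub>R axis i 1)) (?\<phi>1 x) + p (K'' i x) (\<phi> (x + 0 *\<^sub>R axis i 1)))) (at 0)"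
        using K' schwartz_has_pd[OF \<phi>, of i] schwartz_has_pd[OF s(1), of i]
        unfolding has_pd_def by (intro has_vector_derivative_diff has_vector_derivative) blast+
      then show "((\<lambda>r. p (K (x + r *\<^sub>R axis i 1)) (?\<phi>1 (x + r *\<^sub>R axis i 1))
          - p (K' i (x + r *\<^sub>R axis i 1)) (\<phi> (x + r *\<^sub>R axis i 1))) has_vector_derivative
          p (K x) (?\<phi>2 x) - p (K'' i x) (\<phi> x)) (at 0)"
        by simp
    qed
    from integral_partial_derivative_eq_0[OF this _ r C]
    have "(\<integral>x. p (K x) (?\<phi>2 x) - p (K'' i x) (\<phi> x) \<partial>lborel) = 0" by simp
    then show "(\<integral>x. p (K x) (?\<phi>2 x) \<partial>lborel) = (\<integral>x. p (K'' i x) (\<phi> x) \<partial>lborel)"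
      using r2[THEN rapid_integrable] by simp
    show "integrable lborel (\<lambda>x. p (K'' i x) (\<phi> x))" using r2(2) by (rule rapid_integrable)
  qed
  have "(\<Sum>i\<in>UNIV. \<integral>x. p (K x) (partial_deriv i (partial_deriv i \<phi>) x) \<partial>lborel)
      = (\<integral>x. (\<Sum>i\<in>UNIV. p (K'' i x) (\<phi> x)) \<partial>lborel)"
    unfolding pp by (rule Bochner_Integration.integral_sum[symmetric]) (rule int)
  also have "\<dots> = (\<integral>x. - ((norm y)\<^sup>2 *\<^sub>R p (K x) (\<phi> x)) \<partial>lborel)"
    by (simp add: sum_left[symmetric] eig minus_left scaleR_left)
  also have "\<dots> = - ((norm y)\<^sup>2 *\<^sub>R (\<integral>x. p (K x) (\<phi> x) \<partial>lborel))"
    by simp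
  finally show ?thesis by simp
qed

lemma tempered_one_plus_norm: "tempered (\<lambda>x. (1 + norm (x + c)) ^ N)"
proof -
  have "tempered (\<lambda>x. 1 + norm (x + c))"
    unfolding tempered_def
  proof (intro conjI exI allI)
    fix x
    have "1 + norm (x + c) \<le> 1 + (norm x + norm c)" by (intro add_left_mono norm_triangle_ineq)
    also have "\<dots> \<le> (1 + norm c) * (1 + norm x) ^ 1" by (simp add: algebra_simps)
    finally show "norm (1 + norm (x + c)) \<le> (1 + norm c) * (1 + norm x) ^ 1" by simp
  qed measurable
  then show ?thesis by (rule tempered_power)
qed

lemma integrable_weight_rapid: "rapid f \<Longrightarrow> integrable lborel (\<lambda>x. (1 + norm x) ^ N * norm (f x))"
proof -
  assume "rapid f"
  then have "rapid (\<lambda>x. norm (f x))"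
    unfolding rapid_def by (auto intro: borel_measurable_norm)
  then have "rapid (\<lambda>x. (1 + norm (x + 0)) ^ N *\<^sub>R norm (f x))"
    by (rule rapid_bilinear[OF bounded_bilinear_scaleR tempered_one_plus_norm])
  then show ?thesis using rapid_integrable by fastforce
qed

text \<open>Each induction step trades two powers of |y| for two derivatives, hence the
  generalization over \<phi>. The kernel bound enters only at N = 0, so the growth (1 + |y|)^L does
  not accumulate.\<close>

lemma power_weighted_transform_bound:
  fixes k :: "real ^ 'n \<Rightarrow> real ^ 'n \<Rightarrow> 'b::{banach, second_countable_topology}"
    and \<phi> :: "real ^ 'n \<Rightarrow> 'c::{banach, second_countable_topology}"
    and p :: "'b \<Rightarrow> 'c \<Rightarrow> 'd::{banach, second_countable_topology}"
  assumes p: "bounded_bilinear p" and k: "\<And>y. laplace_eigen y (\<lambda>x. k x y)"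
    and bd: "\<And>x y. norm (k x y) \<le> C * ((1 + norm x) ^ L * (1 + norm y) ^ L)" and C: "C > 0"
    and \<phi>: "schwartz \<phi>"
  shows "\<exists>D. \<forall>y. norm y ^ (2 * N) * norm (\<integral>x. p (k x y) (\<phi> x) \<partial>lborel) \<le> D * (1 + norm y) ^ L"
  using \<phi>
proof (induction N arbitrary: \<phi>)
  case 0
  obtain B where B: "B > 0" "\<And>a b. norm (p a b) \<le> norm a * norm b * B"
    using bounded_bilinear.pos_bounded[OF p] by blast
  have i: "integrable lborel (\<lambda>x. (1 + norm x) ^ L * norm (\<phi> x))"
    using 0 by (intro integrable_weight_rapid schwartz_rapid)
  have "norm (\<integral>x. p (k x y) (\<phi> x) \<partial>lborel)
      \<le> (C * B * (\<integral>x. (1 + norm x) ^ L * norm (\<phi> x) \<partial>lborel)) * (1 + norm y) ^ L" for y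
  proof -
    have "norm (\<integral>x. p (k x y) (\<phi> x) \<partial>lborel) \<le> (\<integral>x. norm (p (k x y) (\<phi> x)) \<partial>lborel)"
      by (rule integral_norm_bound)
    also have "\<dots> \<le> (\<integral>x. (C * B * (1 + norm y) ^ L) * ((1 + norm x) ^ L * norm (\<phi> x)) \<partial>lborel)"
    \<comment> \<open>Only the nonnegative majorant must be integrable: a non-integrable left side
      would have integral 0.\<close>
    proof (rule integral_mono')
      fix x
      have "norm (p (k x y) (\<phi> x)) \<le> norm (k x y) * norm (\<phi> x) * B" by (rule B)
      also have "\<dots> \<le> (C * ((1 + norm x) ^ L * (1 + norm y) ^ L)) * norm (\<phi> x) * B"
        using B by (intro mult_right_mono bd) auto
      finally show "norm (p (k x y) (\<phi> x)) \<le> (C * B * (1 + norm y) ^ L) * ((1 + norm x) ^ L * norm (\<phi> x))"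
        by (simp add: mult_ac)
    qed (use i B C in auto)
    also have "\<dots> = (C * B * (1 + norm y) ^ L) * (\<integral>x. (1 + norm x) ^ L * norm (\<phi> x) \<partial>lborel)"
      by (rule integral_mult_right_zero)
    finally show ?thesis by (simp only: mult_ac)
  qed
  then show ?case by (intro exI[of _ "C * B * (\<integral>x. (1 + norm x) ^ L * norm (\<phi> x) \<partial>lborel)"]) simp
next
  case (Suc N)
  have "\<forall>i. \<exists>D. \<forall>y. norm y ^ (2 * N) * norm (\<integral>x. p (k x y) (partial_deriv i (partial_deriv i \<phi>) x) \<partial>lborel)
      \<le> D * (1 + norm y) ^ L"
    using Suc by (simp add: schwartz_partial_deriv)
  then obtain D where D: "\<And>i y. norm y ^ (2 * N)
      * norm (\<integral>x. p (k x y) (partial_deriv i (partial_deriv i \<phi>) x) \<partial>lborel) \<le> D i * (1 + norm y) ^ L"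
    by metis
  have "norm y ^ (2 * Suc N) * norm (\<integral>x. p (k x y) (\<phi> x) \<partial>lborel) \<le> (\<Sum>i\<in>UNIV. D i) * (1 + norm y) ^ L" for y
  proof -
    have "norm y ^ (2 * Suc N) * norm (\<integral>x. p (k x y) (\<phi> x) \<partial>lborel)
        = norm y ^ (2 * N) * norm ((norm y)\<^sup>2 *\<^sub>R (\<integral>x. p (k x y) (\<phi> x) \<partial>lborel))"
      by (simp add: power2_eq_square mult_ac)
    also have "\<dots> \<le> norm y ^ (2 * N)
        * (\<Sum>i\<in>UNIV. norm (\<integral>x. p (k x y) (partial_deriv i (partial_deriv i \<phi>) x) \<partial>lborel))"
      unfolding laplace_eigen_integral[OF p k Suc.prems] norm_minus_cancel
      by (intro mult_left_mono norm_sum) simp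
    also have "\<dots> \<le> (\<Sum>i\<in>UNIV. D i * (1 + norm y) ^ L)"
      unfolding sum_distrib_left by (intro sum_mono D)
    finally show ?thesis by (simp add: sum_distrib_right)
  qed
  then show ?case by blast
qed

lemma one_plus_power_le: "(1 + a) ^ n \<le> 2 ^ n * (1 + a ^ n)" if "0 \<le> a" for a :: real
proof (cases "a \<le> 1")
  case True
  then have "(1 + a) ^ n \<le> 2 ^ n" using that by (intro power_mono) auto
  also have "\<dots> \<le> 2 ^ n * (1 + a ^ n)" using that by simp
  finally show ?thesis .
next
  case False
  then have "(1 + a) ^ n \<le> (2 * a) ^ n" by (intro power_mono) auto
  also have "\<dots> \<le> 2 ^ n * (1 + a ^ n)" by (simp add: power_mult_distrib)
  finally show ?thesis .
qed

lemma rapid_clifford_fourier: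
  fixes f :: "real ^ 'n::{finite,linorder} \<Rightarrow> 'n clifford"
  assumes lam: "CARD('n) = 2 * lam + 2" "lam \<ge> 1" and f: "schwartz f"
  shows "rapid (clifford_fourier f)"
proof -
  note p = bounded_bilinear_clifford_mult
  obtain C where C: "C > 0"
    "\<And>x y :: (real, 'n) vec. norm (clifford_kernel x y) \<le> C * ((1 + norm x) ^ lam * (1 + norm y) ^ lam)"
    using clifford_kernel_bound[OF lam] by blast
  define G where "G y = (\<integral>x. clifford_kernel x y \<star> f x \<partial>lborel)" for y
  have ex: "\<exists>D. \<forall>y. norm y ^ (2 * N) * norm (G y) \<le> D * (1 + norm y) ^ lam" for N
    unfolding G_def
    by (rule power_weighted_transform_bound[OF p laplace_eigen_clifford_kernel[OF lam] C(2,1) f])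
  have G_bd: "\<exists>B. \<forall>y. (1 + norm y) ^ M * norm (G y) \<le> B" for M
  proof -
    \<comment> \<open>The extra lam powers pay for the growth (1 + |y|)^lam of the kernel bound. The
      argument then passes to the exponent 2N because decay is available in even powers.\<close>
    define N where "N = M + lam"
    obtain D0 where D0: "\<And>y. norm (G y) \<le> D0 * (1 + norm y) ^ lam"
      using ex[of 0] by auto
    obtain D where D: "\<And>y. norm y ^ (2 * N) * norm (G y) \<le> D * (1 + norm y) ^ lam"
      using ex[of N] by auto
    have "(1 + norm y) ^ M * norm (G y) \<le> 2 ^ (2 * N) * (D0 + D)" for y
    proof -
      have pos: "0 < (1 + norm y) ^ lam" by (intro zero_less_power) (simp add: add_pos_nonneg)
      have "((1 + norm y) ^ M * norm (G y)) * (1 + norm y) ^ lam = (1 + norm y) ^ N * norm (G y)"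
        by (simp add: N_def power_add mult_ac)
      also have "\<dots> \<le> (1 + norm y) ^ (2 * N) * norm (G y)"
        by (intro mult_right_mono power_increasing) auto
      also have "\<dots> \<le> (2 ^ (2 * N) * (1 + norm y ^ (2 * N))) * norm (G y)"
        by (intro mult_right_mono one_plus_power_le) auto
      also have "\<dots> = 2 ^ (2 * N) * (norm (G y) + norm y ^ (2 * N) * norm (G y))"
        by (simp add: algebra_simps)
      also have "\<dots> \<le> 2 ^ (2 * N) * (D0 * (1 + norm y) ^ lam + D * (1 + norm y) ^ lam)"
        by (intro mult_left_mono add_mono D0 D) auto
      also have "\<dots> = (2 ^ (2 * N) * (D0 + D)) * (1 + norm y) ^ lam"
        by (simp add: algebra_simps)
      finally show ?thesis using pos by (rule mult_right_le_imp_le)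
    qed
    then show ?thesis by blast
  qed
  have fm: "f \<in> borel_measurable borel" using schwartz_rapid[OF f] by (simp add: rapid_def)
  \<comment> \<open>Measurability of the parameter integral follows from joint measurability of its
    integrand, for which the kernel is jointly continuous.\<close>
  have "(\<lambda>q. clifford_kernel (snd q) (fst q) \<star> f (snd q)) \<in> borel_measurable (borel \<Otimes>\<^sub>M lborel)"
  proof (rule borel_measurable_continuous_Pair[where H = "(\<star>)"])
    show "(\<lambda>q. clifford_kernel (snd q) (fst q :: (real, 'n) vec)) \<in> borel_measurable (borel \<Otimes>\<^sub>M lborel)"
      by (rule borel_measurable_continuous_Pair[where H = "\<lambda>a b. clifford_kernel a b"])
         (use continuous_on_clifford_kernel[OF lam] in \<open>measurable\<close>)
    show "(\<lambda>q. f (snd q)) \<in> borel_measurable (borel \<Otimes>\<^sub>M lborel)"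
      using fm by measurable
    show "continuous_on UNIV (\<lambda>q. fst q \<star> snd q :: 'n clifford)"
      by (intro bounded_bilinear.continuous_on[OF p] continuous_on_fst continuous_on_snd continuous_on_id)
  qed
  then have Gm: "G \<in> borel_measurable borel"
    unfolding G_def[abs_def] by (intro lborel.borel_measurable_lebesgue_integral) (simp add: case_prod_unfold)
  have "rapid G" unfolding rapid_def using Gm G_bd by blast
  moreover have "clifford_fourier f = (\<lambda>y. (2 * pi) powr (- (real CARD('n) / 2)) *\<^sub>R G y)"
    by (simp add: clifford_fourier_def G_def fun_eq_iff)
  ultimately show ?thesis
    using rapid_bilinear[OF bounded_bilinear_scaleR tempered_const] by metis
qed

section \<open>The final estimate\<close>

theorem proposition7p2:
  fixes lam :: nat
  assumes "even CARD('n::{finite,linorder})" and "CARD('n) > 2"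
    and "lam = (CARD('n) - 2) div 2"
  shows "\<exists>c>0. \<forall>(f :: (real, 'n) vec \<Rightarrow> 'n clifford) (g :: (real, 'n) vec \<Rightarrow> real).
    schwartz f \<longrightarrow> schwartz g \<longrightarrow> radial g \<longrightarrow>
    (\<forall>\<theta> \<eta> \<mu> x \<omega> :: (real, 'n) vec.
      norm (clifford_stft (radial_translation \<theta> g)
              (clifford_modulation \<eta> (clifford_translation \<mu> f)) x \<omega>)
      \<le> c * (1 + norm \<omega>) ^ lam * (1 + norm \<eta>) ^ lam * (1 + norm \<mu>) ^ lam
          * (1 + norm \<theta>) ^ (3 * lam)
          * (\<integral>z. (1 + norm z) ^ (3 * lam) * \<bar>g (x - z)\<bar> \<partial>lborel)
          * (\<integral>\<xi>. (1 + norm \<xi>) ^ (2 * lam) * norm (clifford_fourier f \<xi>) \<partial>lborel))"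
proof -
  have lam: "CARD('n) = 2 * lam + 2" "lam \<ge> 1"
    using assms by (auto elim!: evenE)
  obtain C where C: "C > 0"
    and k: "\<And>x y :: (real, 'n) vec. norm (clifford_kernel x y) \<le> C * ((1 + norm x) ^ lam * (1 + norm y) ^ lam)"
    using clifford_kernel_bound[OF lam] by blast
  obtain B where B: "B > 0" and m: "\<And>a b :: 'n clifford. norm (a \<star> b) \<le> norm a * norm b * B"
    using bounded_bilinear.pos_bounded[OF bounded_bilinear_clifford_mult] by blast
  define p where "p = (2 * pi) powr (- (real CARD('n) / 2))"
  have p: "p > 0" by (simp add: p_def)
  \<comment> \<open>The price of one integral with its normalization, two kernels and two Clifford
    products. The translation and the short-time transform each cost one such factor, hence the
    witness \<open>q * q\<close>.\<close>
  define q where "q = p * (C * C * B * B)"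
  have pow: "a ^ (2 * lam) = a ^ lam * a ^ lam" "a ^ (3 * lam) = a ^ lam * a ^ lam * a ^ lam" for a :: real
  proof -
    have "2 * lam = lam + lam" "3 * lam = lam + lam + lam" by simp_all
    then show "a ^ (2 * lam) = a ^ lam * a ^ lam" "a ^ (3 * lam) = a ^ lam * a ^ lam * a ^ lam"
      by (simp_all only: power_add)
  qed
  have q: "q > 0" using p C B by (simp add: q_def)
  show ?thesis
  proof (intro exI[of _ "q * q"] conjI allI impI)
    show "0 < q * q" using q by simp
    fix f :: "(real, 'n) vec \<Rightarrow> 'n clifford" and g :: "(real, 'n) vec \<Rightarrow> real" and \<theta> \<eta> \<mu> x \<omega> :: "(real, 'n) vec"
    assume f: "schwartz f" and g: "schwartz g" and rad: "radial g"
    define I where "I = (\<integral>\<xi>. (1 + norm \<xi>) ^ (2 * lam) * norm (clifford_fourier f \<xi>) \<partial>lborel)"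
    define \<tau> where "\<tau> = clifford_translation \<mu> f"
    have I_int: "integrable lborel (\<lambda>\<xi>. (1 + norm \<xi>) ^ (2 * lam) * norm (clifford_fourier f \<xi>))"
      by (intro integrable_weight_rapid rapid_clifford_fourier[OF lam f])
    have I0: "I \<ge> 0" unfolding I_def by (intro Bochner_Integration.integral_nonneg) simp
    have \<tau>: "norm (\<tau> t) \<le> q * (1 + norm \<mu>) ^ lam * I * (1 + norm t) ^ lam" for t
    proof -
      have "norm (\<tau> t) = p * norm (\<integral>\<xi>. clifford_kernel \<xi> t \<star> clifford_kernel \<mu> \<xi> \<star> clifford_fourier f \<xi> \<partial>lborel)"
        using p by (simp add: \<tau>_def clifford_translation_def p_def)
      also have "\<dots> \<le> p * (\<integral>\<xi>. norm (clifford_kernel \<xi> t \<star> clifford_kernel \<mu> \<xi> \<star> clifford_fourier f \<xi>) \<partial>lborel)"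
        using p by (intro mult_left_mono integral_norm_bound) simp
      also have "\<dots> \<le> p * (\<integral>\<xi>. (C * C * B * B * (1 + norm \<mu>) ^ lam * (1 + norm t) ^ lam)
          * ((1 + norm \<xi>) ^ (2 * lam) * norm (clifford_fourier f \<xi>)) \<partial>lborel)"
      proof (intro mult_left_mono integral_mono')
        fix \<xi>
        have "norm (clifford_kernel \<xi> t \<star> clifford_kernel \<mu> \<xi> \<star> clifford_fourier f \<xi>)
            \<le> norm (clifford_kernel \<xi> t) * norm (clifford_kernel \<mu> \<xi>) * B * norm (clifford_fourier f \<xi>) * B"
          using B by (intro order_trans[OF m] mult_right_mono m) auto
        also have "\<dots> \<le> (C * ((1 + norm \<xi>) ^ lam * (1 + norm t) ^ lam))
            * (C * ((1 + norm \<mu>) ^ lam * (1 + norm \<xi>) ^ lam)) * B * norm (clifford_fourier f \<xi>) * B"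
          using B C by (intro mult_right_mono mult_mono k) auto
        also have "\<dots> = (C * C * B * B * (1 + norm \<mu>) ^ lam * (1 + norm t) ^ lam)
            * ((1 + norm \<xi>) ^ (2 * lam) * norm (clifford_fourier f \<xi>))"
          unfolding pow by (simp only: mult_ac)
        finally show "norm (clifford_kernel \<xi> t \<star> clifford_kernel \<mu> \<xi> \<star> clifford_fourier f \<xi>)
            \<le> (C * C * B * B * (1 + norm \<mu>) ^ lam * (1 + norm t) ^ lam)
            * ((1 + norm \<xi>) ^ (2 * lam) * norm (clifford_fourier f \<xi>))" .
      qed (use I_int B C p in auto)
      also have "\<dots> = q * (1 + norm \<mu>) ^ lam * I * (1 + norm t) ^ lam"
        unfolding q_def I_def integral_mult_right_zero by (simp only: mult_ac)
      finally show ?thesis .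
    qed
    define A where "A = q * (1 + norm \<omega>) ^ lam * (1 + norm \<eta>) ^ lam * (1 + norm \<mu>) ^ lam * I"
    have A: "A \<ge> 0" using q I0 by (simp add: A_def)
    \<comment> \<open>Substituting z = t - \<theta> turns g(t - x - \<theta>) into g(z - x) and the
      weight in t into one in z + \<theta>, which is \<open>w \<theta>\<close>; \<open>w 0\<close>
      is what remains once \<theta> is split off.\<close>
    define w where "w c z = (1 + norm (z + c)) ^ (3 * lam) * \<bar>g (z - x)\<bar>" for c z
    have w_int: "integrable lborel (w c)" for c
    proof -
      have gr: "rapid g" using g by (rule schwartz_rapid)
      then have "rapid (\<lambda>z. (1 + norm (z + (x + c))) ^ (3 * lam) * g z)"
        by (rule rapid_bilinear[OF bounded_bilinear_mult tempered_one_plus_norm])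
      then have "integrable lborel (\<lambda>z. \<bar>(1 + norm (z + (x + c))) ^ (3 * lam) * g z\<bar>)"
        by (intro integrable_abs rapid_integrable)
      moreover have "(\<lambda>z. \<bar>(1 + norm (z + (x + c))) ^ (3 * lam) * g z\<bar>) = (\<lambda>z. w c (z + x))"
        by (simp add: w_def abs_mult add.assoc fun_eq_iff)
      moreover have "w c \<in> borel_measurable borel"
        unfolding w_def[abs_def] using gr by (auto simp: rapid_def)
      ultimately show ?thesis by (simp add: integrable_lborel_translate)
    qed
    have w0: "w c z \<ge> 0" for c z by (simp add: w_def)
    have wm: "w c \<in> borel_measurable borel" for c
      using borel_measurable_integrable[OF w_int] by simp
    have "norm (clifford_stft (radial_translation \<theta> g) (clifford_modulation \<eta> \<tau>) x \<omega>)
        = p * norm (\<integral>t. clifford_kernel t \<omega> \<star> (g (t - x - \<theta>) *\<^sub>R (clifford_kernel \<eta> t \<star> \<tau> t)) \<partial>lborel)"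
      using p by (simp add: clifford_stft_def radial_translation_def clifford_modulation_def p_def)
    also have "\<dots> \<le> p * (\<integral>t. norm (clifford_kernel t \<omega> \<star> (g (t - x - \<theta>) *\<^sub>R (clifford_kernel \<eta> t \<star> \<tau> t))) \<partial>lborel)"
      using p by (intro mult_left_mono integral_norm_bound) simp
    also have "\<dots> \<le> p * (\<integral>t. (C * C * B * B * A) * w \<theta> (t + (- \<theta>)) \<partial>lborel)"
    proof (intro mult_left_mono integral_mono')
      show "integrable lborel (\<lambda>t. (C * C * B * B * A) * w \<theta> (t + (- \<theta>)))"
        using w_int[of \<theta>] wm by (intro integrable_mult_right) (simp add: integrable_lborel_translate del: add_uminus_conv_diff)
    next
      fix t
      have "norm (clifford_kernel t \<omega> \<star> (g (t - x - \<theta>) *\<^sub>R (clifford_kernel \<eta> t \<star> \<tau> t)))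
          \<le> norm (clifford_kernel t \<omega>) * (\<bar>g (t - x - \<theta>)\<bar> * (norm (clifford_kernel \<eta> t) * norm (\<tau> t) * B)) * B"
        using B by (intro order_trans[OF m] mult_right_mono mult_left_mono) (auto intro!: mult_left_mono m)
      also have "\<dots> \<le> (C * ((1 + norm t) ^ lam * (1 + norm \<omega>) ^ lam))
          * (\<bar>g (t - x - \<theta>)\<bar> * ((C * ((1 + norm \<eta>) ^ lam * (1 + norm t) ^ lam))
            * (q * (1 + norm \<mu>) ^ lam * I * (1 + norm t) ^ lam) * B)) * B"
        using B C by (intro mult_right_mono mult_left_mono mult_mono k \<tau>) auto
      also have "\<dots> = (C * C * B * B * A) * w \<theta> (t + (- \<theta>))"
      proof -
        have eq: "t + (- \<theta>) + \<theta> = t" "t + (- \<theta>) - x = t - x - \<theta>" by simp_all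
        show ?thesis unfolding A_def w_def eq pow by (simp only: mult_ac)
      qed
      finally show "norm (clifford_kernel t \<omega> \<star> (g (t - x - \<theta>) *\<^sub>R (clifford_kernel \<eta> t \<star> \<tau> t)))
          \<le> (C * C * B * B * A) * w \<theta> (t + (- \<theta>))" .
    qed (use A B C p in \<open>simp_all add: w0\<close>)
    also have "\<dots> = q * A * (\<integral>t. w \<theta> (t + (- \<theta>)) \<partial>lborel)"
      unfolding q_def integral_mult_right_zero by (simp only: mult_ac)
    also have "(\<integral>t. w \<theta> (t + (- \<theta>)) \<partial>lborel) = (\<integral>z. w \<theta> z \<partial>lborel)"
      by (rule integral_lborel_translate[OF wm])
    also have "q * A * \<dots> \<le> q * A * (\<integral>z. (1 + norm \<theta>) ^ (3 * lam) * w 0 z \<partial>lborel)"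
    proof (intro mult_left_mono integral_mono')
      fix z
      have "1 + norm (z + \<theta>) \<le> 1 + (norm z + norm \<theta>)" by (intro add_left_mono norm_triangle_ineq)
      also have "\<dots> \<le> (1 + norm \<theta>) * (1 + norm z)" by (simp add: algebra_simps)
      finally have "(1 + norm (z + \<theta>)) ^ (3 * lam) \<le> ((1 + norm \<theta>) * (1 + norm z)) ^ (3 * lam)"
        by (intro power_mono) auto
      then have "(1 + norm (z + \<theta>)) ^ (3 * lam) * \<bar>g (z - x)\<bar>
          \<le> ((1 + norm \<theta>) * (1 + norm z)) ^ (3 * lam) * \<bar>g (z - x)\<bar>"
        by (rule mult_right_mono) simp
      then show "w \<theta> z \<le> (1 + norm \<theta>) ^ (3 * lam) * w 0 z"
        by (simp add: w_def power_mult_distrib mult_ac)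
    qed (use w_int[of 0] A q in \<open>simp_all add: w0\<close>)
    also have "(\<integral>z. (1 + norm \<theta>) ^ (3 * lam) * w 0 z \<partial>lborel)
        = (1 + norm \<theta>) ^ (3 * lam) * (\<integral>z. (1 + norm z) ^ (3 * lam) * \<bar>g (x - z)\<bar> \<partial>lborel)"
    proof -
      \<comment> \<open>Radiality enters as evenness of g: the window supplies g(z - x), the
        convolution g(x - z).\<close>
      have "w 0 = (\<lambda>z. (1 + norm z) ^ (3 * lam) * \<bar>g (x - z)\<bar>)"
        using rad by (auto simp: w_def radial_def norm_minus_commute)
      then show ?thesis by (simp only: integral_mult_right_zero)
    qed
    finally show "norm (clifford_stft (radial_translation \<theta> g)
              (clifford_modulation \<eta> (clifford_translation \<mu> f)) x \<omega>)
      \<le> q * q * (1 + norm \<omega>) ^ lam * (1 + norm \<eta>) ^ lam * (1 + norm \<mu>) ^ lam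
          * (1 + norm \<theta>) ^ (3 * lam)
          * (\<integral>z. (1 + norm z) ^ (3 * lam) * \<bar>g (x - z)\<bar> \<partial>lborel)
          * (\<integral>\<xi>. (1 + norm \<xi>) ^ (2 * lam) * norm (clifford_fourier f \<xi>) \<partial>lborel)"
      unfolding \<tau>_def[symmetric] I_def[symmetric] A_def by (simp only: mult_ac)
  qed
qed

end
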